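(* Let $C$ be a smooth projective curve over $\mathbb{C}$, $(E,\phi)$ a rank $2$ meromorphic Higgs bundle on $C$ with irreducible spectral curve $\Sigma\subset\overline{T^*C}$, and $a_1=-\operatorname{tr}\phi$, $a_2=\det\phi$. Consider the quantum curve of $\Sigma$, which in a local coordinate $x$ of $C$ is generated by the differential operator $$\left(\hbar\frac{d}{dx}\right)^2+a_1(x)\left(\hbar\frac{d}{dx}\right)+a_2(x).$$ Let $P\in\Sigma\cap C_\infty$ be a point of intersection of $\Sigma$ with the divisor $C_\infty$ at infinity, and suppose that $\rho$ blow-ups at $P$ are required to construct $Bl(\overline{T^*C})$. Then the quantum curve has - a regular singular point at $p=\pi(P)$ if $\rho=1$; - an irregular singular point at $p=\pi(P)$ of class either $\rho-1$ or $\rho-\frac32$ if $\rho>1$, the latter occurring only when $P$ is a cusp singularity of $\Sigma$.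
   Context: **Spectral curve.** $\overline{T^*C}=\mathbb{P}(K_C\oplus\mathcal{O}_C)\xrightarrow{\pi}C$ is the compactified cotangent bundle, $C_\infty=\overline{T^*C}\setminus T^*C$, $\eta$ the tautological $1$-form of $T^*C$ (locally $\eta=y\,dx$) extended meromorphically to $\overline{T^*C}$. A meromorphic Higgs field is an $\mathcal{O}_C$-linear $\phi:E\to K_C(D)\otimes E$, $D$ effective. $\Sigma$ is the zero divisor of $\det(\eta-\pi^*\phi)=\eta^2+\pi^*(a_1)\eta+\pi^*(a_2)$ as a meromorphic section of $\pi^*K_C^{\otimes2}$. Locally $a_1=a_1(x)dx$, $a_2=a_2(x)(dx)^2$. A cusp singularity is a singular point where $\Sigma$ is locally isomorphic to $t^2-s^{2m+1}=0$, $m\ge1$. **Blow-up space.** Let $\Delta=(\frac14a_1^2-a_2)=\Delta_0-\Delta_\infty$ with $\Delta_0=\sum m_iq_i$, $\Delta_\infty=\sum n_jp_j$, $m_i,n_j>0$. Let $k_j,\ell_j$ be the pole orders of $a_1,a_2$ at $p_j$ and $r_j=k_j$ if $2k_j\ge\ell_j$, $r_j=\ell_j/2$ if $2k_j\le\ell_j$. $Bl(\overline{T^*C})$ is obtained from $\overline{T^*C}$ by blowing up, at each $q_i$, $\lfloor m_i/2\rfloor$ times at $\Sigma\cap\pi^{-1}(q_i)$ (iteratively at the singular point of the proper transform of $\Sigma$), and, at each $p_j$, $\lceil r_j\rceil$ times at the point of $\Sigma\cap\pi^{-1}(p_j)$ on $C_\infty$ (iteratively at the intersection point of the proper transforms of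 $\Sigma$ and $C_\infty$). **Singular points.** For $\hbar\ne0$ consider a second order equation $\left(\frac{d^2}{dx^2}+b_1(x)\frac{d}{dx}+b_2(x)\right)\Psi=0$ near $x=0$ with $b_1,b_2$ meromorphic with poles of order $k$, $\ell$ at $x=0$. It has a regular singular point at $x=0$ if $k\le1$ and $\ell\le2$. Otherwise let $r=k$ if $2k\ge\ell$ and $r=\ell/2$ if $2k\le\ell$ (if $b_j\equiv0$ its pole order is set to $-\infty$); the equation has an irregular singular point of class $r-1$ at $x=0$ if $r>1$.
   Formalization: Only the blow-ups at P prescribed at a pole of Δ count towards ρ; if P lies over a zero of Δ (a pole of a_1 cancelling in Δ) nothing is claimed, since there the statement fails, e.g. a_1 with a pole of order 3 and Δ vanishing to order 2. *)

theory Defs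
  imports "HOL-Complex_Analysis.Complex_Analysis" "HOL-Library.Extended_Real"
begin

type_synonym 'a chart = "'a set \<times> ('a \<Rightarrow> complex)"

record 'a curve =
  ctop :: "'a topology"
  atlas :: "'a chart set"

definition is_chart :: "'a topology \<Rightarrow> 'a chart \<Rightarrow> bool" where
  "is_chart X c \<longleftrightarrow> openin X (fst c) \<and> open (snd c ` fst c) \<and>
     homeomorphic_map (subtopology X (fst c)) (top_of_set (snd c ` fst c)) (snd c)"

definition in_coord :: "'a chart \<Rightarrow> ('a \<Rightarrow> 'b) \<Rightarrow> complex \<Rightarrow> 'b" where
  "in_coord c f = (\<lambda>x. f (inv_into (fst c) (snd c) x))"

definition holo_compatible :: "'a chart \<Rightarrow> 'a chart \<Rightarrow> bool" where
  "holo_compatible c c' \<longleftrightarrow>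
     in_coord c (snd c') holomorphic_on snd c ` (fst c \<inter> fst c') \<and>
     in_coord c' (snd c) holomorphic_on snd c' ` (fst c \<inter> fst c')"

definition local_coords :: "'a curve \<Rightarrow> 'a chart set" where
  "local_coords C = {c. is_chart (ctop C) c \<and> (\<forall>c'\<in>atlas C. holo_compatible c c')}"

definition coords_at :: "'a curve \<Rightarrow> 'a \<Rightarrow> 'a chart set" where
  "coords_at C p = {c \<in> local_coords C. p \<in> fst c}"

definition riemann_surface :: "'a curve \<Rightarrow> bool" where
  "riemann_surface C \<longleftrightarrow> Hausdorff_space (ctop C) \<and>
     (\<forall>c\<in>atlas C. is_chart (ctop C) c) \<and>
     (\<forall>c\<in>atlas C. \<forall>c'\<in>atlas C. holo_compatible c c') \<and>
     (\<Union>c\<in>atlas C. fst c) = topspace (ctop C)"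

definition homogeneous_form :: "nat \<Rightarrow> nat \<Rightarrow> ((nat \<Rightarrow> complex) \<Rightarrow> complex) \<Rightarrow> bool" where
  "homogeneous_form n d F \<longleftrightarrow> (\<exists>(M :: (nat \<Rightarrow> nat) set) coef. finite M \<and>
     (\<forall>m\<in>M. (\<Sum>i\<le>n. m i) = d) \<and> F = (\<lambda>v. \<Sum>m\<in>M. coef m * (\<Prod>i\<le>n. v i ^ m i)))"

definition homog_coords :: "nat \<Rightarrow> (nat \<Rightarrow> complex) set" where
  "homog_coords n = {v. (\<exists>i\<le>n. v i \<noteq> 0) \<and> (\<forall>i>n. v i = 0)}"

definition proportional :: "(nat \<Rightarrow> complex) \<Rightarrow> (nat \<Rightarrow> complex) \<Rightarrow> bool" where
  "proportional u v \<longleftrightarrow> (\<exists>t. t \<noteq> 0 \<and> u = (\<lambda>i. t * v i))"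

text \<open>The map \<open>p \<mapsto> [v p]\<close> is an injective holomorphic immersion into \<open>n\<close>-dimensional projective
  space: it has holomorphic lifts \<open>s\<close> for which \<open>s\<close> and its derivative are linearly independent.
  Its image is the common zero locus of a family of homogeneous polynomials.\<close>

definition projective_embedding :: "'a curve \<Rightarrow> nat \<Rightarrow> ('a \<Rightarrow> nat \<Rightarrow> complex) \<Rightarrow> bool" where
  "projective_embedding C n v \<longleftrightarrow>
     (\<forall>p\<in>topspace (ctop C). v p \<in> homog_coords n) \<and>
     (\<forall>p\<in>topspace (ctop C). \<forall>q\<in>topspace (ctop C). proportional (v p) (v q) \<longrightarrow> p = q) \<and>
     (\<forall>p\<in>topspace (ctop C). \<exists>c\<in>coords_at C p. \<exists>s.
        (\<forall>q\<in>fst c. proportional (s q) (v q)) \<and>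
        (\<forall>i. in_coord c (\<lambda>q. s q i) holomorphic_on snd c ` fst c) \<and>
        (\<exists>i j. s p i * deriv (in_coord c (\<lambda>q. s q j)) (snd c p) \<noteq>
               s p j * deriv (in_coord c (\<lambda>q. s q i)) (snd c p))) \<and>
     (\<exists>\<F>. (\<forall>F\<in>\<F>. \<exists>d. homogeneous_form n d F) \<and>
        (\<forall>u\<in>homog_coords n. (\<forall>F\<in>\<F>. F u = 0) \<longleftrightarrow>
           (\<exists>p\<in>topspace (ctop C). proportional u (v p))))"

definition smooth_projective_curve :: "'a curve \<Rightarrow> bool" where
  "smooth_projective_curve C \<longleftrightarrow> riemann_surface C \<and> topspace (ctop C) \<noteq> {} \<and>
     compact_space (ctop C) \<and> connected_space (ctop C) \<and> (\<exists>n v. projective_embedding C n v)"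

definition holo_on_curve :: "'a curve \<Rightarrow> ('a \<Rightarrow> complex) \<Rightarrow> 'a set \<Rightarrow> bool" where
  "holo_on_curve C f V \<longleftrightarrow>
     (\<forall>c\<in>local_coords C. in_coord c f holomorphic_on snd c ` (fst c \<inter> V))"

text \<open>A rank 2 bundle is given by trivialisations over the open sets \<open>triv i\<close> with transition
  matrices \<open>transition i j\<close>.  Over \<open>triv i\<close> the Higgs field is a matrix of meromorphic 1-forms, whose
  coefficient matrix with respect to \<open>dx\<close>, for a local coordinate \<open>c = (U, x)\<close>, is \<open>hfield i c\<close>.
  Values at points of the support of the divisor \<open>poles\<close> carry no information.\<close>

record ('a, 'i) higgs =
  idx :: "'i set"
  triv :: "'i \<Rightarrow> 'a set"
  transition :: "'i \<Rightarrow> 'i \<Rightarrow> 'a \<Rightarrow> complex^2^2"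
  hfield :: "'i \<Rightarrow> 'a chart \<Rightarrow> 'a \<Rightarrow> complex^2^2"
  poles :: "'a \<Rightarrow> nat"

definition rank2_bundle :: "'a curve \<Rightarrow> ('a, 'i) higgs \<Rightarrow> bool" where
  "rank2_bundle C H \<longleftrightarrow>
     (\<forall>i\<in>idx H. openin (ctop C) (triv H i)) \<and>
     (\<Union>i\<in>idx H. triv H i) = topspace (ctop C) \<and>
     (\<forall>i\<in>idx H. \<forall>j\<in>idx H.
        (\<forall>a b. holo_on_curve C (\<lambda>p. transition H i j p $ a $ b) (triv H i \<inter> triv H j)) \<and>
        (\<forall>p\<in>triv H i \<inter> triv H j. det (transition H i j p) \<noteq> 0)) \<and>
     (\<forall>i\<in>idx H. \<forall>j\<in>idx H. \<forall>k\<in>idx H. \<forall>p\<in>triv H i \<inter> triv H j \<inter> triv H k.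
        transition H i j p ** transition H j k p = transition H i k p)"

definition coord_deriv :: "'a chart \<Rightarrow> 'a chart \<Rightarrow> 'a \<Rightarrow> complex" where
  "coord_deriv c' c p = deriv (in_coord c (snd c')) (snd c p)"

definition meromorphic_higgs_bundle :: "'a curve \<Rightarrow> ('a, 'i) higgs \<Rightarrow> bool" where
  "meromorphic_higgs_bundle C H \<longleftrightarrow> rank2_bundle C H \<and>
     finite {p. poles H p \<noteq> 0} \<and> {p. poles H p \<noteq> 0} \<subseteq> topspace (ctop C) \<and>
     (\<forall>i\<in>idx H. \<forall>c\<in>local_coords C. \<forall>a b.
        (\<lambda>x. in_coord c (hfield H i c) x $ a $ b)
           holomorphic_on snd c ` {p \<in> fst c \<inter> triv H i. poles H p = 0} \<and>
        (\<forall>p\<in>fst c \<inter> triv H i. \<exists>h. h analytic_on {snd c p} \<and>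
           (\<forall>\<^sub>F x in at (snd c p).
              (x - snd c p) ^ poles H p * in_coord c (hfield H i c) x $ a $ b = h x))) \<and>
     (\<forall>i\<in>idx H. \<forall>c\<in>local_coords C. \<forall>c'\<in>local_coords C. \<forall>p\<in>fst c \<inter> fst c' \<inter> triv H i.
        poles H p = 0 \<longrightarrow> (\<forall>a b. hfield H i c p $ a $ b =
          coord_deriv c' c p * hfield H i c' p $ a $ b)) \<and>
     (\<forall>i\<in>idx H. \<forall>j\<in>idx H. \<forall>c\<in>local_coords C. \<forall>p\<in>fst c \<inter> triv H i \<inter> triv H j.
        poles H p = 0 \<longrightarrow> hfield H i c p ** transition H i j p = transition H i j p ** hfield H j c p)"

definition frame_at :: "('a, 'i) higgs \<Rightarrow> 'a \<Rightarrow> 'i" where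
  "frame_at H p = (SOME i. i \<in> idx H \<and> p \<in> triv H i)"

definition a1 :: "('a, 'i) higgs \<Rightarrow> 'a chart \<Rightarrow> 'a \<Rightarrow> complex" where
  "a1 H c p = - trace (hfield H (frame_at H p) c p)"

definition a2 :: "('a, 'i) higgs \<Rightarrow> 'a chart \<Rightarrow> 'a \<Rightarrow> complex" where
  "a2 H c p = det (hfield H (frame_at H p) c p)"

definition holo2_on :: "(complex \<times> complex \<Rightarrow> complex) \<Rightarrow> (complex \<times> complex) set \<Rightarrow> bool" where
  "holo2_on f W \<longleftrightarrow>
     (\<forall>z\<in>W. \<exists>a b. (f has_derivative (\<lambda>h. a * fst h + b * snd h)) (at z))"

text \<open>A complex surface is given by its atlas, which also determines the points and the topology.\<close>

type_synonym 's surface = "('s set \<times> ('s \<Rightarrow> complex \<times> complex)) set"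

definition points :: "'s surface \<Rightarrow> 's set" where
  "points S = (\<Union>\<kappa>\<in>S. fst \<kappa>)"

definition open_in :: "'s surface \<Rightarrow> 's set \<Rightarrow> bool" where
  "open_in S W \<longleftrightarrow> W \<subseteq> points S \<and> (\<forall>(N, \<kappa>)\<in>S. open (\<kappa> ` (N \<inter> W)))"

definition holo_on :: "'s surface \<Rightarrow> ('s \<Rightarrow> complex) \<Rightarrow> 's set \<Rightarrow> bool" where
  "holo_on S f W \<longleftrightarrow> (\<forall>(N, \<kappa>)\<in>S. holo2_on (\<lambda>z. f (inv_into N \<kappa> z)) (\<kappa> ` (N \<inter> W)))"

definition closure_in :: "'s surface \<Rightarrow> 's set \<Rightarrow> 's set" where
  "closure_in S Z = {Q \<in> points S. \<forall>W. open_in S W \<and> Q \<in> W \<longrightarrow> W \<inter> Z \<noteq> {}}"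

text \<open>A local coordinate system \<open>\<psi> = (s, t)\<close> on an open set \<open>N\<close>: a biholomorphic map onto an open
  subset of the complex plane squared.\<close>

definition local_coords2 :: "'s surface \<Rightarrow> 's set \<Rightarrow> ('s \<Rightarrow> complex \<times> complex) \<Rightarrow> bool" where
  "local_coords2 S N \<psi> \<longleftrightarrow> open_in S N \<and> inj_on \<psi> N \<and> open (\<psi> ` N) \<and>
     holo_on S (\<lambda>Q. fst (\<psi> Q)) N \<and> holo_on S (\<lambda>Q. snd (\<psi> Q)) N \<and>
     (\<forall>(M, \<kappa>)\<in>S. open (\<psi> ` (M \<inter> N)) \<and>
        holo2_on (\<lambda>z. fst (\<kappa> (inv_into N \<psi> z))) (\<psi> ` (M \<inter> N)) \<and>
        holo2_on (\<lambda>z. snd (\<kappa> (inv_into N \<psi> z))) (\<psi> ` (M \<inter> N)))"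

text \<open>An effective divisor assigns to every point \<open>P\<close> a local equation \<open>D P\<close>, a function that is
  holomorphic near \<open>P\<close>; nearby local equations differ by a unit.\<close>

type_synonym 's divisor = "'s \<Rightarrow> 's \<Rightarrow> complex"

definition effective_divisor :: "'s surface \<Rightarrow> 's divisor \<Rightarrow> bool" where
  "effective_divisor S D \<longleftrightarrow> (\<forall>P\<in>points S. \<exists>N. open_in S N \<and> P \<in> N \<and> holo_on S (D P) N \<and>
     (\<forall>M. open_in S M \<and> M \<subseteq> N \<and> M \<noteq> {} \<longrightarrow> (\<exists>R\<in>M. D P R \<noteq> 0)) \<and>
     (\<forall>Q\<in>N. \<exists>M u. open_in S M \<and> Q \<in> M \<and> M \<subseteq> N \<and> holo_on S u M \<and>
        (\<forall>R\<in>M. u R \<noteq> 0 \<and> D Q R = u R * D P R)))"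

definition same_divisor :: "'s surface \<Rightarrow> 's divisor \<Rightarrow> 's divisor \<Rightarrow> bool" where
  "same_divisor S D E \<longleftrightarrow> (\<forall>P\<in>points S. \<exists>N u. open_in S N \<and> P \<in> N \<and> holo_on S u N \<and>
     (\<forall>Q\<in>N. u Q \<noteq> 0 \<and> D P Q = u Q * E P Q))"

definition divisor_sum :: "'s divisor \<Rightarrow> 's divisor \<Rightarrow> 's divisor" where
  "divisor_sum D E = (\<lambda>P Q. D P Q * E P Q)"

definition support :: "'s surface \<Rightarrow> 's divisor \<Rightarrow> 's set" where
  "support S D = {P \<in> points S. D P P = 0}"

text \<open>Irreducible (and reduced), i.e. a prime divisor; an effective divisor is zero iff its support
  is empty.\<close>

definition irreducible_divisor :: "'s surface \<Rightarrow> 's divisor \<Rightarrow> bool" where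
  "irreducible_divisor S D \<longleftrightarrow> effective_divisor S D \<and> support S D \<noteq> {} \<and>
     (\<forall>D1 D2. effective_divisor S D1 \<and> effective_divisor S D2 \<and>
        same_divisor S D (divisor_sum D1 D2) \<longrightarrow> support S D1 = {} \<or> support S D2 = {})"

definition coprime_at :: "'s surface \<Rightarrow> 's \<Rightarrow> ('s \<Rightarrow> complex) \<Rightarrow> ('s \<Rightarrow> complex) \<Rightarrow> bool" where
  "coprime_at S Q f h \<longleftrightarrow> (\<forall>N d e e'. open_in S N \<and> Q \<in> N \<and>
     holo_on S d N \<and> holo_on S e N \<and> holo_on S e' N \<and>
     (\<forall>R\<in>N. f R = d R * e R \<and> h R = d R * e' R) \<longrightarrow> d Q \<noteq> 0)"

text \<open>The curve \<open>Z\<close> is a reduced curve given as a set of points; it is smooth at \<open>Q\<close> iff near \<open>Q\<close> it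
  is the zero set of a holomorphic function with nonvanishing differential.\<close>

definition smooth_at :: "'s surface \<Rightarrow> 's set \<Rightarrow> 's \<Rightarrow> bool" where
  "smooth_at S Z Q \<longleftrightarrow> (\<exists>N f. open_in S N \<and> Q \<in> N \<and> holo_on S f N \<and>
     Z \<inter> N = {R \<in> N. f R = 0} \<and>
     (\<exists>(M, \<kappa>)\<in>S. Q \<in> M \<and> (\<exists>a b. (a, b) \<noteq> (0, 0) \<and>
        ((\<lambda>z. f (inv_into M \<kappa> z)) has_derivative (\<lambda>h. a * fst h + b * snd h)) (at (\<kappa> Q)))))"

definition singular_point :: "'s surface \<Rightarrow> 's set \<Rightarrow> 's \<Rightarrow> bool" where
  "singular_point S Z Q \<longleftrightarrow> Q \<in> Z \<and> \<not> smooth_at S Z Q"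

text \<open>As \<open>m \<ge> 1\<close>, the origin is a singular point of the model curve.\<close>

definition cusp_singularity :: "'s surface \<Rightarrow> 's divisor \<Rightarrow> 's \<Rightarrow> bool" where
  "cusp_singularity S D P \<longleftrightarrow> (\<exists>m N \<psi> u. 1 \<le> (m::nat) \<and>
     local_coords2 S N \<psi> \<and> P \<in> N \<and> \<psi> P = (0, 0) \<and> holo_on S u N \<and>
     (\<forall>Q\<in>N. u Q \<noteq> 0 \<and> D P Q = u Q * (snd (\<psi> Q) ^ 2 - fst (\<psi> Q) ^ (2 * m + 1))))"

text \<open>A cotangent vector at \<open>p\<close> is the family \<open>\<xi>\<close> of its coefficients: it equals \<open>\<xi> (U, x) dx\<close> for
  every local coordinate \<open>(U, x)\<close> at \<open>p\<close>.  The point \<open>[\<xi> : 1]\<close> of the projective line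
  \<open>P(K \<oplus> O)\<close> over \<open>p\<close> is \<open>Cov p \<xi>\<close>, and \<open>[1 : 0]\<close> is \<open>AtInf p\<close>.\<close>

datatype 'a tpoint = Cov 'a "'a chart \<Rightarrow> complex" | AtInf 'a

definition cotangent_vectors :: "'a curve \<Rightarrow> 'a \<Rightarrow> ('a chart \<Rightarrow> complex) set" where
  "cotangent_vectors C p = {\<xi>.
     (\<forall>c\<in>coords_at C p. \<forall>c'\<in>coords_at C p. \<xi> c = coord_deriv c' c p * \<xi> c') \<and>
     (\<forall>c. c \<notin> coords_at C p \<longrightarrow> \<xi> c = 0)}"

fun proj :: "'a tpoint \<Rightarrow> 'a" where
  "proj (Cov p \<xi>) = p"
| "proj (AtInf p) = p"

text \<open>The coordinates of the two charts over \<open>(U, x)\<close> are \<open>(x, y)\<close> and \<open>(x, 1/y)\<close>, where the point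
  is \<open>y dx\<close>.\<close>

definition affine_chart :: "'a curve \<Rightarrow> 'a chart \<Rightarrow> 'a tpoint set \<times> ('a tpoint \<Rightarrow> complex \<times> complex)" where
  "affine_chart C c = ({Cov p \<xi> |p \<xi>. p \<in> fst c \<and> \<xi> \<in> cotangent_vectors C p},
     (\<lambda>Q. case Q of Cov p \<xi> \<Rightarrow> (snd c p, \<xi> c) | AtInf p \<Rightarrow> undefined))"

definition infinity_chart :: "'a curve \<Rightarrow> 'a chart \<Rightarrow> 'a tpoint set \<times> ('a tpoint \<Rightarrow> complex \<times> complex)" where
  "infinity_chart C c =
     ({Cov p \<xi> |p \<xi>. p \<in> fst c \<and> \<xi> \<in> cotangent_vectors C p \<and> \<xi> c \<noteq> 0} \<union> {AtInf p |p. p \<in> fst c},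
      (\<lambda>Q. case Q of Cov p \<xi> \<Rightarrow> (snd c p, 1 / \<xi> c) | AtInf p \<Rightarrow> (snd c p, 0)))"

definition Tbar :: "'a curve \<Rightarrow> 'a tpoint surface" where
  "Tbar C = affine_chart C ` local_coords C \<union> infinity_chart C ` local_coords C"

definition C_infinity :: "'a curve \<Rightarrow> 'a tpoint set" where
  "C_infinity C = AtInf ` topspace (ctop C)"

text \<open>The coefficient with respect to \<open>dx\<close> of the tautological 1-form, at a point of the cotangent
  bundle.\<close>

definition eta :: "'a chart \<Rightarrow> 'a tpoint \<Rightarrow> complex" where
  "eta c Q = (case Q of Cov p \<xi> \<Rightarrow> \<xi> c | AtInf p \<Rightarrow> undefined)"

definition char_section :: "('a, 'i) higgs \<Rightarrow> 'a chart \<Rightarrow> 'a tpoint \<Rightarrow> complex" where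
  "char_section H c Q = det (mat (eta c Q) - hfield H (frame_at H (proj Q)) c (proj Q))"

lemma char_section_eq:
  "char_section H c Q = eta c Q ^ 2 + a1 H c (proj Q) * eta c Q + a2 H c (proj Q)"
  by (simp add: char_section_def a1_def a2_def det_2 trace_def sum_2 mat_def power2_eq_square
      algebra_simps)

text \<open>Near each point the meromorphic section is \<open>\<Sigma> Q / h\<close> in lowest terms.\<close>

definition spectral_curve :: "'a curve \<Rightarrow> ('a, 'i) higgs \<Rightarrow> 'a tpoint divisor \<Rightarrow> bool" where
  "spectral_curve C H \<Sigma> \<longleftrightarrow> effective_divisor (Tbar C) \<Sigma> \<and>
     (\<forall>Q\<in>points (Tbar C). \<forall>c\<in>coords_at C (proj Q). \<exists>N h.
        open_in (Tbar C) N \<and> Q \<in> N \<and> holo_on (Tbar C) (\<Sigma> Q) N \<and> holo_on (Tbar C) h N \<and>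
        coprime_at (Tbar C) Q (\<Sigma> Q) h \<and>
        (\<forall>R\<in>N. R \<notin> C_infinity C \<and> proj R \<in> fst c \<and> poles H (proj R) = 0 \<longrightarrow>
           \<Sigma> Q R = h R * char_section H c R))"

definition pole_order :: "(complex \<Rightarrow> complex) \<Rightarrow> complex \<Rightarrow> ereal" where
  "pole_order f z = (if \<forall>\<^sub>F x in at z. f x = 0 then -\<infinity> else ereal (- real_of_int (zorder f z)))"

definition invariant_r :: "ereal \<Rightarrow> ereal \<Rightarrow> ereal" where
  "invariant_r k l = (if 2 * k \<ge> l then k else l / 2)"

text \<open>The order of a meromorphic (quadratic) differential does not depend on the coordinate.\<close>

definition form_pole_order :: "'a curve \<Rightarrow> ('a chart \<Rightarrow> 'a \<Rightarrow> complex) \<Rightarrow> 'a \<Rightarrow> ereal" where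
  "form_pole_order C a p =
     (let c = (SOME c. c \<in> coords_at C p) in pole_order (in_coord c (a c)) (snd c p))"

definition discriminant :: "('a, 'i) higgs \<Rightarrow> 'a chart \<Rightarrow> 'a \<Rightarrow> complex" where
  "discriminant H c p = 1/4 * a1 H c p ^ 2 - a2 H c p"

definition Delta_zeros :: "'a curve \<Rightarrow> ('a, 'i) higgs \<Rightarrow> 'a set" where
  "Delta_zeros C H = {q \<in> topspace (ctop C).
     -\<infinity> < form_pole_order C (discriminant H) q \<and> form_pole_order C (discriminant H) q < 0}"

definition Delta_poles :: "'a curve \<Rightarrow> ('a, 'i) higgs \<Rightarrow> 'a set" where
  "Delta_poles C H = {p \<in> topspace (ctop C). 0 < form_pole_order C (discriminant H) p}"

definition zero_mult :: "'a curve \<Rightarrow> ('a, 'i) higgs \<Rightarrow> 'a \<Rightarrow> real" where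
  "zero_mult C H q = - real_of_ereal (form_pole_order C (discriminant H) q)"

definition r_at :: "'a curve \<Rightarrow> ('a, 'i) higgs \<Rightarrow> 'a \<Rightarrow> real" where
  "r_at C H p =
     real_of_ereal (invariant_r (form_pole_order C (a1 H) p) (form_pole_order C (a2 H) p))"

text \<open>The points of all iterated blow-ups of a surface: blowing up \<open>P\<close> replaces it by the exceptional
  curve of all \<open>Exc P m\<close>, where \<open>m\<close> is the slope \<open>v/u\<close> of a tangent direction at \<open>P\<close> in a chart
  \<open>(u, v)\<close> centred at \<open>P\<close>, and \<open>None\<close> stands for the infinite slope.  Other points keep their name.
  The chart at \<open>P\<close> is chosen arbitrarily; the result is independent of it up to isomorphism.\<close>

datatype 's npoint = Base 's | Exc "'s npoint" "complex option"

fun base_point :: "'s npoint \<Rightarrow> 's" where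
  "base_point (Base Q) = Q"
| "base_point (Exc P m) = base_point P"

definition base_surface :: "'s surface \<Rightarrow> 's npoint surface" where
  "base_surface S = (\<lambda>(N, \<kappa>). (Base ` N, \<lambda>Q. \<kappa> (base_point Q))) ` S"

definition chart_at :: "'s surface \<Rightarrow> 's \<Rightarrow> 's set \<times> ('s \<Rightarrow> complex \<times> complex)" where
  "chart_at S P = (SOME \<kappa>. \<kappa> \<in> S \<and> P \<in> fst \<kappa>)"

definition blowup :: "'s npoint surface \<Rightarrow> 's npoint \<Rightarrow> 's npoint surface" where
  "blowup S P =
     (let N = fst (chart_at S P); \<kappa> = snd (chart_at S P);
          u = (\<lambda>Q. fst (\<kappa> Q) - fst (\<kappa> P)); v = (\<lambda>Q. snd (\<kappa> Q) - snd (\<kappa> P))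
      in (\<lambda>(M, \<mu>). (M - {P}, \<mu>)) ` S \<union>
         {({Q \<in> N - {P}. u Q \<noteq> 0} \<union> {Exc P (Some m) |m. True},
           \<lambda>Q. if \<exists>m. Q = Exc P (Some m) then (0, THE m. Q = Exc P (Some m)) else (u Q, v Q / u Q)),
          ({Q \<in> N - {P}. v Q \<noteq> 0} \<union> {Exc P (Some m) |m. m \<noteq> 0} \<union> {Exc P None},
           \<lambda>Q. if \<exists>m. Q = Exc P (Some m) then (1 / (THE m. Q = Exc P (Some m)), 0)
               else if Q = Exc P None then (0, 0) else (u Q / v Q, v Q))})"

definition proper_transform :: "'s npoint surface \<Rightarrow> 's npoint \<Rightarrow> 's npoint set \<Rightarrow> 's npoint set" where
  "proper_transform S P Z = closure_in (blowup S P) (Z - {P})"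

fun blowups :: "'s npoint surface \<Rightarrow> 's npoint list \<Rightarrow> 's npoint surface" where
  "blowups S [] = S"
| "blowups S (P # Ps) = blowups (blowup S P) Ps"

fun proper_transforms :: "'s npoint surface \<Rightarrow> 's npoint set \<Rightarrow> 's npoint list \<Rightarrow> 's npoint set" where
  "proper_transforms S Z [] = Z"
| "proper_transforms S Z (P # Ps) = proper_transforms (blowup S P) (proper_transform S P Z) Ps"

text \<open>The successive centres of the blow-ups constructing \<open>Bl\<close>: over a zero \<open>q\<close> of the discriminant
  the centre is a singular point of the proper transform of \<open>\<Sigma>\<close>; over a pole \<open>p\<close> it is
  infinitely near to \<open>AtInf p\<close> and lies on the proper transforms of \<open>\<Sigma>\<close> and of the divisor at
  infinity.\<close>

definition constructs_Bl ::
    "'a curve \<Rightarrow> ('a, 'i) higgs \<Rightarrow> 'a tpoint divisor \<Rightarrow> 'a tpoint npoint list \<Rightarrow> bool" where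
  "constructs_Bl C H \<Sigma> Ps \<longleftrightarrow>
     (\<forall>k<length Ps.
        let S = base_surface (Tbar C);
            S' = blowups S (take k Ps);
            Z = proper_transforms S (Base ` support (Tbar C) \<Sigma>) (take k Ps);
            L = proper_transforms S (Base ` C_infinity C) (take k Ps)
        in (\<exists>q\<in>Delta_zeros C H. proj (base_point (Ps ! k)) = q \<and> singular_point S' Z (Ps ! k)) \<or>
           (\<exists>p\<in>Delta_poles C H. base_point (Ps ! k) = AtInf p \<and> Ps ! k \<in> Z \<inter> L)) \<and>
     (\<forall>q\<in>Delta_zeros C H.
        int (card {k. k < length Ps \<and> proj (base_point (Ps ! k)) = q}) = \<lfloor>zero_mult C H q / 2\<rfloor>) \<and>
     (\<forall>p\<in>Delta_poles C H.
        int (card {k. k < length Ps \<and> base_point (Ps ! k) = AtInf p}) = \<lceil>r_at C H p\<rceil>)"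

text \<open>The blow-ups at a point \<open>P\<close> of the divisor at infinity are those prescribed at the poles of the
  discriminant.  If \<open>a1\<close> has a pole at a zero \<open>q\<close> of the discriminant, then \<open>\<Sigma>\<close> meets the
  divisor at infinity over \<open>q\<close> as well, but the blow-ups over \<open>q\<close>, governed by the vanishing order
  of the discriminant instead of by the pole orders, are not counted here.\<close>

definition blowups_at_infinity ::
    "'a curve \<Rightarrow> ('a, 'i) higgs \<Rightarrow> 'a tpoint npoint list \<Rightarrow> 'a tpoint \<Rightarrow> nat" where
  "blowups_at_infinity C H Ps P =
     (if proj P \<in> Delta_poles C H then card {k. k < length Ps \<and> base_point (Ps ! k) = P} else 0)"

type_synonym diff_op = "(complex \<Rightarrow> complex) \<Rightarrow> complex \<Rightarrow> complex"

definition quantum_curve_op ::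
    "('a, 'i) higgs \<Rightarrow> complex \<Rightarrow> 'a chart \<Rightarrow> diff_op" where
  "quantum_curve_op H hbar c = (\<lambda>\<Psi> x.
     hbar * deriv (\<lambda>t. hbar * deriv \<Psi> t) x
     + in_coord c (a1 H c) x * (hbar * deriv \<Psi> x) + in_coord c (a2 H c) x * \<Psi> x)"

text \<open>Near \<open>x = 0\<close> the equation \<open>L \<Psi> = 0\<close> is, after division by its leading coefficient,
  \<open>\<Psi>'' + b1 \<Psi>' + b2 \<Psi> = 0\<close>.\<close>

definition normal_form :: "diff_op \<Rightarrow> (complex \<Rightarrow> complex) \<Rightarrow> (complex \<Rightarrow> complex) \<Rightarrow> bool" where
  "normal_form L b1 b2 \<longleftrightarrow> b1 meromorphic_on {0} \<and> b2 meromorphic_on {0} \<and>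
     (\<exists>r e. 0 < (r::real) \<and> (\<forall>x\<in>ball 0 r - {0}. e x \<noteq> 0 \<and>
        (\<forall>\<Psi>. \<Psi> analytic_on {x} \<longrightarrow>
           L \<Psi> x = e x * (deriv (deriv \<Psi>) x + b1 x * deriv \<Psi> x + b2 x * \<Psi> x))))"

definition regular_singular_at_0 :: "diff_op \<Rightarrow> bool" where
  "regular_singular_at_0 L \<longleftrightarrow> (\<exists>b1 b2. normal_form L b1 b2 \<and>
     (0 < pole_order b1 0 \<or> 0 < pole_order b2 0) \<and>
     pole_order b1 0 \<le> 1 \<and> pole_order b2 0 \<le> 2)"

definition irregular_singular_at_0 :: "diff_op \<Rightarrow> real \<Rightarrow> bool" where
  "irregular_singular_at_0 L cl \<longleftrightarrow> (\<exists>b1 b2. normal_form L b1 b2 \<and>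
     \<not> (pole_order b1 0 \<le> 1 \<and> pole_order b2 0 \<le> 2) \<and>
     (let r = invariant_r (pole_order b1 0) (pole_order b2 0) in 1 < r \<and> ereal cl = r - 1))"

end

theory Submission
  imports Defs
begin

text \<open>Let \<open>k\<close> and \<open>l\<close> be the pole orders of \<open>a1\<close> and \<open>a2\<close> at \<open>p\<close>, and let \<open>r\<close> be the invariant formed from them.
If \<open>p\<close> is a pole of the discriminant, the number \<open>\<rho>\<close> of blow-ups at the point over \<open>p\<close> is \<open>r\<close>
rounded up; otherwise \<open>\<rho> = 0\<close> and nothing is claimed.  Division of the quantum curve by
its leading coefficient \<open>hbar\<^sup>2\<close> gives the coefficients \<open>a1/hbar\<close> and \<open>a2/hbar\<^sup>2\<close>, which have the same pole
orders, so that the same \<open>r\<close> governs the singular point of the equation.  As \<open>r\<close> is an integer or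
half of one, \<open>r\<close> is \<open>\<rho>\<close> or \<open>\<rho> - 1/2\<close>, and the class \<open>r - 1\<close> is \<open>\<rho> - 1\<close> or \<open>\<rho> - 3/2\<close>
(\<open>invariant_r_ceiling\<close>).  The normal form is unique (\<open>normal_form_quantum_curve_unique\<close>), hence so is the
class, and the pole orders do not depend on the coordinate that is used to compute them
(\<open>form_pole_order_a\<close>).

The second alternative forces \<open>r = l/2\<close> with \<open>l = 2m + 1\<close> odd and \<open>k \<le> m\<close>.  In the coordinates \<open>x\<close> and
\<open>w = 1/y\<close> at infinity, with \<open>a1 = \<beta>/x\<^sup>m\<close> and \<open>a2 = \<alpha>/x\<^sup>l\<close>, \<open>\<alpha>\<close> a unit, the characteristic polynomial is
\<open>G/(x\<^sup>l w\<^sup>2)\<close> with \<open>G = x\<^sup>l + x\<^bsup>m+1\<^esup> \<beta> w + \<alpha> w\<^sup>2\<close>.  Completing the square and absorbing the remaining unit into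
\<open>x\<close> turns \<open>G\<close> into a unit times \<open>t\<^sup>2 - s\<^sup>l\<close> in new coordinates \<open>(s, t)\<close> (\<open>cusp_normal_form\<close>); this is the
cusp.

The spectral curve is only known as the numerator of the characteristic polynomial in lowest terms, so
it must be shown that \<open>G\<close> is such a numerator.  It vanishes identically neither on \<open>x = 0\<close> nor on
\<open>w = 0\<close>, and a holomorphic function of two variables that vanishes on one of these lines is divisible
by \<open>x\<close> or \<open>w\<close>.  Therefore any numerator and denominator arise from \<open>G\<close> and \<open>x\<^sup>l w\<^sup>2\<close> by multiplication
with a common factor (\<open>holo2_divide_monomial\<close>), and coprimality makes this factor a unit.  The divisibility
rests on Osgood's lemma and Cauchy's integral formula.  Finally, holomorphy on the compactified cotangent
bundle refers to all of its charts; that a computation in one chart suffices is because a chart at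
infinity is a local coordinate system (\<open>infinity_chart_local_coords2\<close>).\<close>

section \<open>Holomorphic functions of two variables\<close>

lemma holo2_on_subset: "holo2_on f W \<Longrightarrow> V \<subseteq> W \<Longrightarrow> holo2_on f V"
  by (auto simp: holo2_on_def)

lemma holo2_on_cong:
  assumes "open W" "\<And>z. z \<in> W \<Longrightarrow> f z = g z" "holo2_on f W"
  shows "holo2_on g W"
  unfolding holo2_on_def
proof
  fix z assume z: "z \<in> W"
  with assms(3) obtain a b where "(f has_derivative (\<lambda>h. a * fst h + b * snd h)) (at z)"
    by (auto simp: holo2_on_def)
  then have "(g has_derivative (\<lambda>h. a * fst h + b * snd h)) (at z)"
    by (rule has_derivative_transform_within_open[OF _ assms(1) z]) (use assms(2) in auto)
  then show "\<exists>a b. (g has_derivative (\<lambda>h. a * fst h + b * snd h)) (at z)" by blast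
qed

lemma holo2_on_local:
  assumes "\<And>z. z \<in> W \<Longrightarrow> \<exists>V. z \<in> V \<and> holo2_on f V"
  shows "holo2_on f W"
  using assms unfolding holo2_on_def by metis

lemma holo2_on_imp_continuous_on: "holo2_on f W \<Longrightarrow> continuous_on W f"
  unfolding holo2_on_def
  by (meson continuous_at_imp_continuous_on has_derivative_continuous)

lemma holo2_on_const: "holo2_on (\<lambda>_. k) W"
  unfolding holo2_on_def
  by (auto intro!: exI[of _ 0] derivative_eq_intros)

lemma holo2_on_fst: "holo2_on fst W"
  unfolding holo2_on_def
  by (intro ballI exI[of _ 1] exI[of _ 0]) (auto intro!: derivative_eq_intros)

lemma holo2_on_snd: "holo2_on snd W"
  unfolding holo2_on_def
  by (intro ballI exI[of _ 0] exI[of _ 1]) (auto intro!: derivative_eq_intros)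

lemma holo2_on_mult:
  assumes "holo2_on f W" "holo2_on g W"
  shows "holo2_on (\<lambda>z. f z * g z) W"
  unfolding holo2_on_def
proof
  fix z assume "z \<in> W"
  with assms obtain a b a' b' where
    "(f has_derivative (\<lambda>h. a * fst h + b * snd h)) (at z)"
    "(g has_derivative (\<lambda>h. a' * fst h + b' * snd h)) (at z)"
    unfolding holo2_on_def by meson
  from has_derivative_mult[OF this]
  show "\<exists>a b. ((\<lambda>z. f z * g z) has_derivative (\<lambda>h. a * fst h + b * snd h)) (at z)"
    by (intro exI[of _ "f z * a' + a * g z"] exI[of _ "f z * b' + b * g z"])
      (simp add: algebra_simps)
qed

lemma holo2_on_add:
  assumes "holo2_on f W" "holo2_on g W"
  shows "holo2_on (\<lambda>z. f z + g z) W"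
  unfolding holo2_on_def
proof
  fix z assume "z \<in> W"
  with assms obtain a b a' b' where
    "(f has_derivative (\<lambda>h. a * fst h + b * snd h)) (at z)"
    "(g has_derivative (\<lambda>h. a' * fst h + b' * snd h)) (at z)"
    unfolding holo2_on_def by meson
  from has_derivative_add[OF this]
  show "\<exists>a b. ((\<lambda>z. f z + g z) has_derivative (\<lambda>h. a * fst h + b * snd h)) (at z)"
    by (intro exI[of _ "a + a'"] exI[of _ "b + b'"]) (simp add: algebra_simps)
qed

lemma holo2_on_power: "holo2_on f W \<Longrightarrow> holo2_on (\<lambda>z. f z ^ n) W"
  by (induction n) (auto intro: holo2_on_const holo2_on_mult)

lemma holo2_on_compose_holomorphic:
  assumes "f holomorphic_on A" "open A" "holo2_on g W" "g ` W \<subseteq> A"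
  shows "holo2_on (\<lambda>z. f (g z)) W"
  unfolding holo2_on_def
proof
  fix z assume z: "z \<in> W"
  with assms(3) obtain a b where g: "(g has_derivative (\<lambda>h. a * fst h + b * snd h)) (at z)"
    unfolding holo2_on_def by meson
  have "(f has_derivative (*) (deriv f (g z))) (at (g z))"
    using holomorphic_derivI[OF assms(1,2)] z assms(4) by (auto simp: has_field_derivative_def)
  from diff_chain_at[OF g this]
  show "\<exists>a b. ((\<lambda>z. f (g z)) has_derivative (\<lambda>h. a * fst h + b * snd h)) (at z)"
    by (intro exI[of _ "deriv f (g z) * a"] exI[of _ "deriv f (g z) * b"])
      (simp add: o_def algebra_simps)
qed

lemma holo2_on_compose:
  assumes "holo2_on f V" "holo2_on p W" "holo2_on q W" "\<And>z. z \<in> W \<Longrightarrow> (p z, q z) \<in> V"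
  shows "holo2_on (\<lambda>z. f (p z, q z)) W"
  unfolding holo2_on_def
proof
  fix z assume z: "z \<in> W"
  with assms(2,3) obtain a b a' b' where
    pq: "(p has_derivative (\<lambda>h. a * fst h + b * snd h)) (at z)"
    "(q has_derivative (\<lambda>h. a' * fst h + b' * snd h)) (at z)"
    unfolding holo2_on_def by meson
  obtain A B where f: "(f has_derivative (\<lambda>h. A * fst h + B * snd h)) (at (p z, q z))"
    using assms(1,4) z unfolding holo2_on_def by meson
  from diff_chain_at[OF has_derivative_Pair[OF pq] f]
  show "\<exists>a b. ((\<lambda>z. f (p z, q z)) has_derivative (\<lambda>h. a * fst h + b * snd h)) (at z)"
    by (intro exI[of _ "A * a + B * a'"] exI[of _ "A * b + B * b'"])
      (simp add: o_def algebra_simps)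
qed

lemmas holo2_intros = holo2_on_const holo2_on_fst holo2_on_snd holo2_on_mult holo2_on_add
  holo2_on_power

lemma holo2_on_swap: "holo2_on f V \<Longrightarrow> holo2_on (\<lambda>z. f (snd z, fst z)) {z. (snd z, fst z) \<in> V}"
  by (rule holo2_on_compose) (auto intro: holo2_intros)

lemma holo2_on_partial:
  assumes "holo2_on F W" "(x, w) \<in> W"
  shows "(\<lambda>x. F (x, w)) field_differentiable at x" "(\<lambda>w. F (x, w)) field_differentiable at w"
proof -
  obtain a b where F: "(F has_derivative (\<lambda>h. a * fst h + b * snd h)) (at (x, w))"
    using assms unfolding holo2_on_def by meson
  have 1: "((\<lambda>x. (x, w)) has_derivative (\<lambda>h. (h, 0))) (at x)"
    by (auto intro!: derivative_eq_intros)
  have 2: "((\<lambda>w. (x, w)) has_derivative (\<lambda>h. (0, h))) (at w)"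
    by (auto intro!: derivative_eq_intros)
  have "((\<lambda>x. F (x, w)) has_field_derivative a) (at x)"
    using diff_chain_at[OF 1 F] by (simp add: o_def has_field_derivative_def)
  then show "(\<lambda>x. F (x, w)) field_differentiable at x" by (auto simp: field_differentiable_def)
  have "((\<lambda>w. F (x, w)) has_field_derivative b) (at w)"
    using diff_chain_at[OF 2 F] by (simp add: o_def has_field_derivative_def)
  then show "(\<lambda>w. F (x, w)) field_differentiable at w" by (auto simp: field_differentiable_def)
qed

lemma continuous_on_circle_integral:
  fixes K :: "'a::topological_space \<Rightarrow> complex \<Rightarrow> complex"
  assumes K: "continuous_on (U \<times> sphere z r) (\<lambda>(p, \<zeta>). K p \<zeta>)" and "0 \<le> r"
  shows "continuous_on U (\<lambda>p. contour_integral (circlepath z r) (K p))"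
proof -
  have "continuous_on (U \<times> cbox 0 1)
      (\<lambda>(p, t). K p (circlepath z r t) * (2 * pi * \<i> * r * exp (2 * of_real pi * \<i> * of_real t)))"
    unfolding split_def
  proof (rule continuous_on_mult)
    have "continuous_on (U \<times> cbox 0 1) (\<lambda>x. circlepath z r (snd x))"
      unfolding circlepath by (intro continuous_intros)
    then have c: "continuous_on (U \<times> cbox 0 1) (\<lambda>x. (fst x, circlepath z r (snd x)))"
      by (intro continuous_intros)
    have s: "circlepath z r t \<in> sphere z r" if "t \<in> {0..1}" for t
      using that path_image_circlepath_nonneg[OF assms(2), of z] by (auto simp: path_image_def)
    show "continuous_on (U \<times> cbox 0 1) (\<lambda>x. K (fst x) (circlepath z r (snd x)))"
      using continuous_on_compose2[OF K c] s by (force simp: split_def)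
  qed (intro continuous_intros)
  from integral_continuous_on_param[OF this]
  show ?thesis
    by (simp add: contour_integral_integral vector_derivative_circlepath)
qed

lemma open_contains_cball_product:
  fixes W :: "('a::metric_space \<times> 'b::metric_space) set"
  assumes "open W" "(x, w) \<in> W"
  obtains r where "0 < r" "cball x r \<times> cball w r \<subseteq> W"
proof -
  obtain A B where AB: "open A" "open B" "x \<in> A" "w \<in> B" "A \<times> B \<subseteq> W"
    using open_prod_elim[OF assms] by (metis mem_Sigma_iff)
  obtain r1 r2 where "0 < r1" "cball x r1 \<subseteq> A" "0 < r2" "cball w r2 \<subseteq> B"
    using AB open_contains_cball by metis
  then show thesis
    using AB(5) by (intro that[of "min r1 r2"]) (auto simp: subset_iff)
qed

text \<open>Cauchy's formula writes the derivative as an integral over a fixed circle, and such an integral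
depends continuously on its parameters.\<close>

lemma continuous_on_deriv_snd:
  fixes F :: "complex \<times> complex \<Rightarrow> complex"
  assumes "open W" and cont: "continuous_on W F"
    and holo: "\<And>x w. (x, w) \<in> W \<Longrightarrow> (\<lambda>w. F (x, w)) field_differentiable at w"
  shows "continuous_on W (\<lambda>(x, w). deriv (\<lambda>w. F (x, w)) w)"
proof -
  have "continuous (at (x0, w0)) (\<lambda>(x, w). deriv (\<lambda>w. F (x, w)) w)" if xw: "(x0, w0) \<in> W" for x0 w0
  proof -
    obtain r where r: "0 < r" "cball x0 r \<times> cball w0 r \<subseteq> W"
      using open_contains_cball_product[OF assms(1) xw] by metis
    let ?U = "ball x0 r \<times> ball w0 r"
    have eq: "deriv (\<lambda>w. F (x, w)) w = 1 / (2 * of_real pi * \<i>) *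
        contour_integral (circlepath w0 r) (\<lambda>u. F (x, u) / (u - w)^2)" if "(x, w) \<in> ?U" for x w
    proof (rule DERIV_imp_deriv, rule Cauchy_derivative_integral_circlepath)
      show "continuous_on (cball w0 r) (\<lambda>w. F (x, w))"
        by (rule continuous_on_compose2[OF cont])
          (use that r in \<open>auto intro!: continuous_intros simp: subset_iff\<close>)
      have "(x, u) \<in> W" if "u \<in> ball w0 r" for u
        using r(2) that \<open>(x, w) \<in> ?U\<close> by (auto simp: subset_iff)
      then show "(\<lambda>w. F (x, w)) holomorphic_on ball w0 r"
        using holo by (simp add: holomorphic_on_open field_differentiable_def)
    qed (use that in auto)
    have "continuous_on (?U \<times> sphere w0 r) (\<lambda>(p, u). F (fst p, u) / (u - snd p)^2)"
      unfolding split_def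
    proof (intro continuous_on_divide)
      show "continuous_on (?U \<times> sphere w0 r) (\<lambda>x. F (fst (fst x), snd x))"
        by (rule continuous_on_compose2[OF cont])
          (use r in \<open>auto intro!: continuous_intros simp: subset_iff\<close>)
      show "continuous_on (?U \<times> sphere w0 r) (\<lambda>p. (snd p - snd (fst p))\<^sup>2)"
        by (intro continuous_intros)
    qed auto
    from continuous_on_circle_integral[OF this] r(1)
    have "continuous_on ?U (\<lambda>p. 1 / (2 * of_real pi * \<i>) *
        contour_integral (circlepath w0 r) (\<lambda>u. F (fst p, u) / (u - snd p)^2))"
      by (intro continuous_intros) auto
    then have "continuous_on ?U (\<lambda>(x, w). deriv (\<lambda>w. F (x, w)) w)"
      by (subst continuous_on_cong[OF refl]) (auto simp: eq)
    moreover have "open ?U" "(x0, w0) \<in> ?U" using r(1) by (auto simp: open_Times)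
    ultimately show ?thesis using continuous_on_eq_continuous_at by blast
  qed
  then show ?thesis
    by (intro continuous_at_imp_continuous_on ballI) (metis prod.collapse)
qed

text \<open>Osgood's lemma.  Continuity of one partial derivative is enough to combine the partial derivatives
into a total one, and it is automatic by Cauchy's formula.\<close>

lemma osgood:
  assumes "open W" and cont: "continuous_on W F"
    and holox: "\<And>x w. (x, w) \<in> W \<Longrightarrow> (\<lambda>x. F (x, w)) field_differentiable at x"
    and holow: "\<And>x w. (x, w) \<in> W \<Longrightarrow> (\<lambda>w. F (x, w)) field_differentiable at w"
  shows "holo2_on F W"
  unfolding holo2_on_def
proof
  fix z assume z: "z \<in> W"
  obtain x0 w0 where zeq: "z = (x0, w0)" by (cases z)
  have xw: "(x0, w0) \<in> W" using z zeq by simp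
  obtain r where r: "0 < r" "cball x0 r \<times> cball w0 r \<subseteq> W"
    using open_contains_cball_product[OF assms(1) xw] by metis
  let ?X = "ball x0 r" let ?Y = "ball w0 r"
  have XY: "(x, w) \<in> W" if "x \<in> ?X" "w \<in> ?Y" for x w using that r by (auto simp: subset_iff)
  have o: "open (?X \<times> ?Y)" by (simp add: open_Times)
  have xw0: "(x0, w0) \<in> ?X \<times> ?Y" using r(1) by simp
  let ?a = "deriv (\<lambda>x. F (x, w0)) x0"
  let ?b = "\<lambda>x w. deriv (\<lambda>w. F (x, w)) w"
  have "((\<lambda>(x, w). F (x, w)) has_derivative
      (\<lambda>(tx, tw). ?a * tx + blinfun_mult_right (?b x0 w0) tw)) (at (x0, w0) within ?X \<times> ?Y)"
  proof (rule has_derivative_partialsI[where f = "\<lambda>x w. F (x, w)" and fx = "(*) ?a"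
        and fy = "\<lambda>x w. blinfun_mult_right (?b x w)"])
    show "((\<lambda>x. F (x, w0)) has_derivative (*) ?a) (at x0 within ?X)"
      using field_differentiable_derivI[OF holox[OF xw]]
      unfolding has_field_derivative_def by (rule has_derivative_at_withinI)
    show "((\<lambda>w. F (x, w)) has_derivative blinfun_apply (blinfun_mult_right (?b x w))) (at w within ?Y)"
      if "x \<in> ?X" "w \<in> ?Y" for x w
      using field_differentiable_derivI[OF holow[OF XY[OF that]]]
      unfolding has_field_derivative_def blinfun_mult_right.rep_eq by (rule has_derivative_at_withinI)
    have "continuous_on (?X \<times> ?Y) (\<lambda>(x, w). ?b x w)"
      by (rule continuous_on_subset[OF continuous_on_deriv_snd[OF assms(1) cont holow]])
        (use XY in auto)
    then have "continuous_on (?X \<times> ?Y) (\<lambda>(x, w). blinfun_mult_right (?b x w))"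
      using bounded_linear.continuous_on[OF bounded_linear_blinfun_mult_right] by (simp add: split_def)
    then show "continuous (at (x0, w0) within ?X \<times> ?Y) (\<lambda>(x, w). blinfun_mult_right (?b x w))"
      using r(1) by (simp add: continuous_on_eq_continuous_within)
  qed (use r in auto)
  then have "(F has_derivative (\<lambda>h. ?a * fst h + ?b x0 w0 * snd h)) (at (x0, w0))"
    unfolding at_within_open[OF xw0 o] by (simp add: split_def)
  then show "\<exists>a b. (F has_derivative (\<lambda>h. a * fst h + b * snd h)) (at z)"
    unfolding zeq by (rule exI[of _ ?a, OF exI[of _ "?b x0 w0"]])
qed

lemma open_square_in_open:
  fixes W :: "(complex \<times> complex) set"
  assumes "open W" "(0, 0) \<in> W"
  obtains r where "0 < r" "ball 0 r \<times> ball 0 r \<subseteq> W"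
proof -
  obtain r where "0 < r" "cball 0 r \<times> cball 0 r \<subseteq> W"
    using open_contains_cball_product[OF assms] .
  moreover have "ball 0 r \<times> ball 0 r \<subseteq> cball (0::complex) r \<times> cball (0::complex) r" by auto
  ultimately show thesis using that by blast
qed

section \<open>Division by a monomial\<close>

text \<open>The quotient is \<open>h(x, w)/x\<close>, with the partial derivative of \<open>h\<close> as its value on the line \<open>x = 0\<close>.  On a
smaller disc in \<open>x\<close> it is given by Cauchy's formula, where the integrand involves \<open>h\<close> only away from
that line; so it is continuous and holomorphic in \<open>w\<close> across the line, and Osgood's lemma applies.\<close>

lemma holo2_divide_by_fst:
  assumes r: "0 < r" and h: "holo2_on h (ball 0 r \<times> ball 0 r)"
    and zero: "\<And>w. w \<in> ball 0 r \<Longrightarrow> h (0, w) = 0"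
  obtains g where "holo2_on g (ball 0 r \<times> ball 0 r)"
    "\<And>x w. x \<in> ball 0 r \<Longrightarrow> w \<in> ball 0 r \<Longrightarrow> h (x, w) = x * g (x, w)"
proof -
  let ?B = "ball (0::complex) r"
  have o: "open (?B \<times> ?B)" by (simp add: open_Times)
  have cont: "continuous_on (?B \<times> ?B) h" by (rule holo2_on_imp_continuous_on[OF h])
  have hx: "(\<lambda>x. h (x, w)) holomorphic_on ?B" if "w \<in> ?B" for w
    using holo2_on_partial(1)[OF h] that by (simp add: holomorphic_on_open field_differentiable_def)
  define g where "g = (\<lambda>(x, w). if x = 0 then deriv (\<lambda>x. h (x, w)) 0 else h (x, w) / x)"
  have gx: "(\<lambda>x. g (x, w)) holomorphic_on ?B" if "w \<in> ?B" for w
    using pole_lemma[OF hx[OF that], of 0] r that by (simp add: g_def zero cong: if_cong)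
  \<comment> \<open>On the circle of integration \<open>g\<close> is \<open>h/u\<close>, so the special values on \<open>x = 0\<close> do not enter.\<close>
  have cauchy: "g (x, w) = 1 / (2 * of_real pi * \<i>) *
      contour_integral (circlepath 0 s) (\<lambda>u. h (u, w) / (u * (u - x)))"
    if s: "0 < s" "s < r" and "x \<in> ball 0 s" "w \<in> ?B" for s x w
  proof -
    have "((\<lambda>u. g (u, w) / (u - x)) has_contour_integral (2 * of_real pi * \<i> * g (x, w)))
        (circlepath 0 s)"
      by (rule Cauchy_integral_circlepath_simple)
        (use that in \<open>auto intro!: holomorphic_on_subset[OF gx]\<close>)
    moreover have "contour_integral (circlepath 0 s) (\<lambda>u. g (u, w) / (u - x)) =
        contour_integral (circlepath 0 s) (\<lambda>u. h (u, w) / (u * (u - x)))"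
      by (rule contour_integral_cong) (use s in \<open>auto simp: g_def\<close>)
    ultimately have "contour_integral (circlepath 0 s) (\<lambda>u. h (u, w) / (u * (u - x))) =
        2 * of_real pi * \<i> * g (x, w)"
      by (metis contour_integral_unique)
    then show ?thesis by simp
  qed
  have hcs: "continuous_on (A \<times> sphere 0 s) (\<lambda>z. h (snd z, k (fst z)))"
    if "s < r" "continuous_on A k" "k ` A \<subseteq> ?B" for s A and k :: "'b::topological_space \<Rightarrow> complex"
  proof (rule continuous_on_compose2[OF cont])
    have "continuous_on (A \<times> sphere 0 s) (\<lambda>z. k (fst z))"
      by (rule continuous_on_compose2[OF that(2)]) (auto intro: continuous_intros)
    then show "continuous_on (A \<times> sphere 0 s) (\<lambda>z. (snd z, k (fst z)))"
      by (intro continuous_intros)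
  qed (use that in auto)
  have "holo2_on g (?B \<times> ?B)"
  proof (rule osgood[OF o])
    have "continuous (at (x, w)) g" if xw: "x \<in> ?B" "w \<in> ?B" for x w
    proof -
      obtain s where s: "norm x < s" "s < r" using xw dense by auto
      have s0: "0 < s" using s by (meson le_less_trans norm_ge_zero)
      let ?U = "ball 0 s \<times> ?B"
      have "continuous_on (?U \<times> sphere 0 s) (\<lambda>(p, u). h (u, snd p) / (u * (u - fst p)))"
        unfolding split_def using s s0
        by (intro continuous_on_divide hcs continuous_intros) auto
      from continuous_on_circle_integral[OF this] s0
      have "continuous_on ?U (\<lambda>p. 1 / (2 * of_real pi * \<i>) *
          contour_integral (circlepath 0 s) (\<lambda>u. h (u, snd p) / (u * (u - fst p))))"
        by (intro continuous_intros) auto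
      then have "continuous_on ?U g"
        by (subst continuous_on_cong[OF refl]) (use cauchy[OF s0 s(2)] in auto)
      moreover have "open ?U" "(x, w) \<in> ?U" using s xw by (auto simp: open_Times)
      ultimately show ?thesis using continuous_on_eq_continuous_at by blast
    qed
    then show "continuous_on (?B \<times> ?B) g"
      by (intro continuous_at_imp_continuous_on ballI) (metis mem_Times_iff prod.collapse)
    show "(\<lambda>x. g (x, w)) field_differentiable at x" if "(x, w) \<in> ?B \<times> ?B" for x w
      using gx[of w] that holomorphic_on_imp_differentiable_at by blast
    show "(\<lambda>w. g (x, w)) field_differentiable at w" if "(x, w) \<in> ?B \<times> ?B" for x w
    proof (cases "x = 0")
      case False
      then show ?thesis
        using holo2_on_partial(2)[OF h that]
        by (auto simp: g_def intro!: derivative_intros)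
    next
      case True
      obtain s where s: "0 < s" "s < r" using r dense by auto
      let ?\<gamma> = "circlepath 0 s"
      let ?d = "\<lambda>t::real. 2 * pi * \<i> * s * exp (2 * of_real pi * \<i> * of_real t)"
      have \<gamma>: "?\<gamma> t \<in> ?B" "?\<gamma> t \<noteq> 0" for t using s by (auto simp: circlepath norm_mult)
      have \<gamma>c: "continuous_on A (\<lambda>x. ?\<gamma> (k x))" if "continuous_on A k" for A
        and k :: "'b::topological_space \<Rightarrow> real"
        unfolding circlepath by (intro continuous_intros that)
      have hw: "((\<lambda>w. h (x, w)) has_field_derivative deriv (\<lambda>w. h (x, w)) w) (at w)"
        if "x \<in> ?B" "w \<in> ?B" for x w
        using holo2_on_partial(2)[OF h] that field_differentiable_derivI by blast
      have "(\<lambda>w. integral (cbox 0 1) (\<lambda>t. h (?\<gamma> t, w) / (?\<gamma> t * ?\<gamma> t) * ?d t)) holomorphic_on ?B"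
      proof (rule leibniz_rule_holomorphic)
        show "((\<lambda>w. h (?\<gamma> t, w) / (?\<gamma> t * ?\<gamma> t) * ?d t) has_field_derivative
            deriv (\<lambda>w. h (?\<gamma> t, w)) w / (?\<gamma> t * ?\<gamma> t) * ?d t) (at w within ?B)"
          if "w \<in> ?B" for w t
          by (rule DERIV_cmult_right, rule DERIV_cdivide, rule has_field_derivative_at_within,
              rule hw[OF \<gamma>(1) that(1)])
        show "(\<lambda>t. h (?\<gamma> t, w) / (?\<gamma> t * ?\<gamma> t) * ?d t) integrable_on cbox 0 1" if "w \<in> ?B" for w
        proof (rule integrable_continuous, intro continuous_on_mult continuous_on_divide \<gamma>c)
          show "continuous_on (cbox 0 1) (\<lambda>t. h (?\<gamma> t, w))"
            by (rule continuous_on_compose2[OF cont])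
              (use that \<gamma> in \<open>auto intro!: continuous_intros \<gamma>c\<close>)
        qed (use \<gamma> in \<open>auto intro!: continuous_intros\<close>)
        show "continuous_on (?B \<times> cbox 0 1)
            (\<lambda>(w, t). deriv (\<lambda>w. h (?\<gamma> t, w)) w / (?\<gamma> t * ?\<gamma> t) * ?d t)"
          unfolding split_def
        proof (intro continuous_on_mult continuous_on_divide \<gamma>c)
          have "continuous_on (?B \<times> cbox 0 1)
            (\<lambda>x. (\<lambda>(x, w). deriv (\<lambda>w. h (x, w)) w) (?\<gamma> (snd x), fst x))"
            by (rule continuous_on_compose2[OF continuous_on_deriv_snd[OF o cont]])
              (use \<gamma> in \<open>auto intro!: continuous_intros \<gamma>c holo2_on_partial(2)[OF h]\<close>)
          then show "continuous_on (?B \<times> cbox 0 1) (\<lambda>x. deriv (\<lambda>w. h (?\<gamma> (snd x), w)) (fst x))"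
            by simp
        qed (use \<gamma> in \<open>auto intro!: continuous_intros\<close>)
      qed auto
      then have "(\<lambda>w. 1 / (2 * of_real pi * \<i>) *
          contour_integral ?\<gamma> (\<lambda>u. h (u, w) / (u * (u - 0)))) holomorphic_on ?B"
        by (auto intro!: holomorphic_intros
          simp: contour_integral_integral vector_derivative_circlepath)
      then have "(\<lambda>w. g (0, w)) holomorphic_on ?B"
        by (rule holomorphic_transform) (use cauchy[OF s] s in auto)
      then show ?thesis
        using True that holomorphic_on_imp_differentiable_at by blast
    qed
  qed
  moreover have "h (x, w) = x * g (x, w)" if "x \<in> ?B" "w \<in> ?B" for x w
    using that zero by (auto simp: g_def)
  ultimately show thesis using that by blast
qed

lemma continuous_on_zero_at_0:
  fixes f :: "complex \<Rightarrow> complex"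
  assumes "0 < r" "continuous_on (ball 0 r) f" "\<And>x. x \<in> ball 0 r \<Longrightarrow> x \<noteq> 0 \<Longrightarrow> f x = 0"
  shows "f 0 = 0"
proof -
  have "(f \<longlongrightarrow> f 0) (at 0)"
    using assms(1,2) by (simp add: continuous_on_eq_continuous_at isCont_def)
  moreover have "(f \<longlongrightarrow> 0) (at 0)"
    by (rule tendsto_eventually) (use assms in \<open>auto simp: eventually_at intro!: exI[of _ r]\<close>)
  ultimately show ?thesis using tendsto_unique trivial_limit_at by blast
qed

text \<open>Identities obtained by cancelling \<open>x\<close> and \<open>w\<close> hold at first only off the axes.\<close>

lemma continuous_on_eq_off_axes:
  fixes f g :: "complex \<times> complex \<Rightarrow> complex"
  assumes r: "0 < r"
    and cont: "continuous_on (ball 0 r \<times> ball 0 r) f" "continuous_on (ball 0 r \<times> ball 0 r) g"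
    and eq: "\<And>x w. x \<in> ball 0 r \<Longrightarrow> w \<in> ball 0 r \<Longrightarrow> x \<noteq> 0 \<Longrightarrow> w \<noteq> 0 \<Longrightarrow> f (x, w) = g (x, w)"
    and xw: "x \<in> ball 0 r" "w \<in> ball 0 r"
  shows "f (x, w) = g (x, w)"
proof -
  let ?B = "ball (0::complex) r"
  define d where "d z = f z - g z" for z
  have d: "continuous_on (?B \<times> ?B) d" unfolding d_def by (intro continuous_intros cont)
  have c1: "continuous_on ?B (\<lambda>x. d (x, w))" if "w \<in> ?B" for w
    by (rule continuous_on_compose2[OF d]) (use that in \<open>auto intro!: continuous_intros\<close>)
  have c2: "continuous_on ?B (\<lambda>w. d (x, w))" if "x \<in> ?B" for x
    by (rule continuous_on_compose2[OF d]) (use that in \<open>auto intro!: continuous_intros\<close>)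
  have 1: "d (x, w) = 0" if "x \<in> ?B" "w \<in> ?B" "w \<noteq> 0" for x w
    using continuous_on_zero_at_0[OF r c1[of w]] that eq by (cases "x = 0") (auto simp: d_def)
  have "d (x, w) = 0"
    using continuous_on_zero_at_0[OF r c2[of x]] xw 1 by (cases "w = 0") auto
  then show ?thesis by (simp add: d_def)
qed

text \<open>As \<open>G\<close> does not vanish on the punctured line \<open>x = 0\<close>, the factor \<open>h\<close> vanishes there, and one power of
\<open>x\<close> can be cancelled.\<close>

lemma holo2_divide_power_fst:
  assumes r: "0 < r"
    and hol: "holo2_on f (ball 0 r \<times> ball 0 r)" "holo2_on h (ball 0 r \<times> ball 0 r)"
      "holo2_on G (ball 0 r \<times> ball 0 r)"
    and G: "\<And>w. w \<in> ball 0 r \<Longrightarrow> w \<noteq> 0 \<Longrightarrow> G (0, w) \<noteq> 0"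
    and eq: "\<And>x w. x \<in> ball 0 r \<Longrightarrow> w \<in> ball 0 r \<Longrightarrow> x ^ n * f (x, w) = h (x, w) * G (x, w)"
  obtains e where "holo2_on e (ball 0 r \<times> ball 0 r)"
    "\<And>x w. x \<in> ball 0 r \<Longrightarrow> w \<in> ball 0 r \<Longrightarrow> h (x, w) = x ^ n * e (x, w) \<and> f (x, w) = e (x, w) * G (x, w)"
proof -
  let ?B = "ball (0::complex) r"
  have "\<exists>e. holo2_on e (?B \<times> ?B) \<and>
      (\<forall>x\<in>?B. \<forall>w\<in>?B. h (x, w) = x ^ n * e (x, w) \<and> f (x, w) = e (x, w) * G (x, w))"
    using hol(2) eq
  proof (induction n arbitrary: h)
    case 0
    then show ?case by (intro exI[of _ h]) auto
  next
    case (Suc n)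
    have c: "continuous_on ?B (\<lambda>w. h (0, w))"
      by (rule continuous_on_compose2[OF holo2_on_imp_continuous_on[OF Suc.prems(1)]])
        (use r in \<open>auto intro!: continuous_intros\<close>)
    have 1: "h (0, w) = 0" if "w \<in> ?B" "w \<noteq> 0" for w
      using Suc.prems(2)[of 0 w] that r G by auto
    have "h (0, w) = 0" if "w \<in> ?B" for w
      using continuous_on_zero_at_0[OF r c 1] 1 that by (cases "w = 0") auto
    then obtain g where g: "holo2_on g (?B \<times> ?B)"
      "\<And>x w. x \<in> ?B \<Longrightarrow> w \<in> ?B \<Longrightarrow> h (x, w) = x * g (x, w)"
      using holo2_divide_by_fst[OF r Suc.prems(1)] by metis
    have "x ^ n * f (x, w) = g (x, w) * G (x, w)" if "x \<in> ?B" "w \<in> ?B" for x w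
    proof -
      have "(\<lambda>z. fst z ^ n * f z) (x, w) = (\<lambda>z. g z * G z) (x, w)"
      proof (rule continuous_on_eq_off_axes[OF r])
        show "continuous_on (?B \<times> ?B) (\<lambda>z. fst z ^ n * f z)" "continuous_on (?B \<times> ?B) (\<lambda>z. g z * G z)"
          by (intro holo2_on_imp_continuous_on holo2_intros hol g)+
        fix x w assume "x \<in> ?B" "w \<in> ?B" "x \<noteq> 0" "w \<noteq> 0"
        then show "fst (x, w) ^ n * f (x, w) = g (x, w) * G (x, w)"
          using Suc.prems(2)[of x w] g(2)[of x w] by auto
      qed (use that in auto)
      then show ?thesis by simp
    qed
    from Suc.IH[OF g(1) this] g(2) show ?case by (metis mult.assoc power_Suc)
  qed
  then show thesis using that by blast
qed

lemma holo2_divide_power_snd: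
  assumes r: "0 < r"
    and hol: "holo2_on f (ball 0 r \<times> ball 0 r)" "holo2_on h (ball 0 r \<times> ball 0 r)"
      "holo2_on G (ball 0 r \<times> ball 0 r)"
    and G: "\<And>x. x \<in> ball 0 r \<Longrightarrow> x \<noteq> 0 \<Longrightarrow> G (x, 0) \<noteq> 0"
    and eq: "\<And>x w. x \<in> ball 0 r \<Longrightarrow> w \<in> ball 0 r \<Longrightarrow> w ^ n * f (x, w) = h (x, w) * G (x, w)"
  obtains e where "holo2_on e (ball 0 r \<times> ball 0 r)"
    "\<And>x w. x \<in> ball 0 r \<Longrightarrow> w \<in> ball 0 r \<Longrightarrow> h (x, w) = w ^ n * e (x, w) \<and> f (x, w) = e (x, w) * G (x, w)"
proof -
  let ?P = "ball (0::complex) r \<times> ball (0::complex) r"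
  have sw: "holo2_on (\<lambda>z. k (snd z, fst z)) ?P" if "holo2_on k ?P" for k
    using holo2_on_swap[OF that] by (rule holo2_on_subset) auto
  obtain e where e: "holo2_on e ?P" "\<And>x w. x \<in> ball 0 r \<Longrightarrow> w \<in> ball 0 r \<Longrightarrow>
      h (w, x) = x ^ n * e (x, w) \<and> f (w, x) = e (x, w) * G (w, x)"
    using holo2_divide_power_fst[OF r sw[OF hol(1)] sw[OF hol(2)] sw[OF hol(3)], of n] G eq by auto
  show thesis
    by (rule that[OF sw[OF e(1)]]) (use e(2) in auto)
qed

text \<open>If a fraction \<open>f/h\<close> equals \<open>G/(x\<^sup>n w\<^sup>k)\<close> and \<open>G\<close> vanishes identically on no axis, then \<open>f\<close> and \<open>h\<close> are obtained from
\<open>G\<close> and \<open>x\<^sup>n w\<^sup>k\<close> by expanding the fraction with a holomorphic \<open>e\<close>.\<close>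

lemma holo2_divide_monomial:
  assumes r: "0 < r"
    and hol: "holo2_on f (ball 0 r \<times> ball 0 r)" "holo2_on h (ball 0 r \<times> ball 0 r)"
      "holo2_on G (ball 0 r \<times> ball 0 r)"
    and G: "\<And>w. w \<in> ball 0 r \<Longrightarrow> w \<noteq> 0 \<Longrightarrow> G (0, w) \<noteq> 0"
      "\<And>x. x \<in> ball 0 r \<Longrightarrow> x \<noteq> 0 \<Longrightarrow> G (x, 0) \<noteq> 0"
    and eq: "\<And>x w. x \<in> ball 0 r \<Longrightarrow> w \<in> ball 0 r \<Longrightarrow> x \<noteq> 0 \<Longrightarrow> w \<noteq> 0 \<Longrightarrow>
      x ^ n * w ^ k * f (x, w) = h (x, w) * G (x, w)"
  obtains e where "holo2_on e (ball 0 r \<times> ball 0 r)"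
    "\<And>x w. x \<in> ball 0 r \<Longrightarrow> w \<in> ball 0 r \<Longrightarrow>
      h (x, w) = e (x, w) * (x ^ n * w ^ k) \<and> f (x, w) = e (x, w) * G (x, w)"
proof -
  let ?B = "ball (0::complex) r"
  have hk: "holo2_on (\<lambda>z. snd z ^ k * f z) (?B \<times> ?B)"
    by (intro holo2_intros hol)
  have "fst (x, w) ^ n * (snd (x, w) ^ k * f (x, w)) = h (x, w) * G (x, w)"
    if "x \<in> ?B" "w \<in> ?B" for x w
  proof -
    have "(\<lambda>z. fst z ^ n * (snd z ^ k * f z)) (x, w) = (\<lambda>z. h z * G z) (x, w)"
    proof (rule continuous_on_eq_off_axes[OF r])
      show "continuous_on (?B \<times> ?B) (\<lambda>z. fst z ^ n * (snd z ^ k * f z))"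
        "continuous_on (?B \<times> ?B) (\<lambda>z. h z * G z)"
        by (intro holo2_on_imp_continuous_on holo2_intros hol)+
    qed (use that eq in \<open>auto simp: mult.assoc\<close>)
    then show ?thesis by simp
  qed
  then obtain e1 where e1: "holo2_on e1 (?B \<times> ?B)"
    "\<And>x w. x \<in> ?B \<Longrightarrow> w \<in> ?B \<Longrightarrow>
      h (x, w) = x ^ n * e1 (x, w) \<and> w ^ k * f (x, w) = e1 (x, w) * G (x, w)"
    using holo2_divide_power_fst[OF r hk hol(2,3) G(1), of n] by auto
  obtain e where e: "holo2_on e (?B \<times> ?B)"
    "\<And>x w. x \<in> ?B \<Longrightarrow> w \<in> ?B \<Longrightarrow> e1 (x, w) = w ^ k * e (x, w) \<and> f (x, w) = e (x, w) * G (x, w)"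
    using holo2_divide_power_snd[OF r hol(1) e1(1) hol(3) G(2), of k] e1(2) by metis
  show thesis
  proof (rule that[OF e(1)])
    fix x w assume "x \<in> ?B" "w \<in> ?B"
    with e(2) e1(2) have "h (x, w) = x ^ n * (w ^ k * e (x, w))" "f (x, w) = e (x, w) * G (x, w)"
      by metis+
    then show "h (x, w) = e (x, w) * (x ^ n * w ^ k) \<and> f (x, w) = e (x, w) * G (x, w)"
      by (simp add: mult_ac)
  qed
qed

section \<open>The normal form of a cusp\<close>

text \<open>Completing the square in \<open>w\<close> leaves \<open>x\<^bsup>2m+1\<^esup>\<close> times a unit, and the unit has a root of order \<open>2m + 1\<close> near the
origin, which is absorbed into the coordinate \<open>s\<close>.\<close>

lemma cusp_normal_form:
  fixes \<alpha> \<beta> :: "complex \<Rightarrow> complex" and m :: nat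
  assumes "0 < r" and hol: "\<alpha> holomorphic_on ball 0 r" "\<beta> holomorphic_on ball 0 r"
    and nz: "\<And>x. x \<in> ball 0 r \<Longrightarrow> \<alpha> x \<noteq> 0"
  obtains \<delta> s b where "0 < \<delta>" "\<delta> \<le> r" "s holomorphic_on ball 0 \<delta>" "b holomorphic_on ball 0 \<delta>"
    "inj_on s (ball 0 \<delta>)" "s 0 = 0" "b 0 = 0"
    "\<And>x w. x \<in> ball 0 \<delta> \<Longrightarrow>
      x ^ (2 * m + 1) + x ^ (m + 1) * \<beta> x * w + \<alpha> x * w ^ 2 =
      \<alpha> x * ((w + b x) ^ 2 - s x ^ (2 * m + 1))"
proof -
  \<comment> \<open>With \<open>b\<close> as below, the left-hand side is \<open>\<alpha> (w + b)\<^sup>2 - \<alpha> x\<^bsup>2m+1\<^esup> v\<close>, because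
    \<open>\<alpha> b\<^sup>2 = x\<^bsup>2m+2\<^esup> \<beta>\<^sup>2 / (4 \<alpha>)\<close>.\<close>
  define v where "v x = - (1 - x * \<beta> x ^ 2 / (4 * \<alpha> x)) / \<alpha> x" for x
  have v: "v holomorphic_on ball 0 r"
    unfolding v_def by (intro holomorphic_intros hol) (use nz in auto)
  have "v 0 \<noteq> 0" using nz[of 0] \<open>0 < r\<close> by (simp add: v_def)
  then obtain d where d: "0 < d" "\<And>x. dist 0 x < d \<Longrightarrow> dist 0 x < r \<Longrightarrow> v x \<noteq> 0"
  proof -
    have "isCont v 0"
      using holomorphic_on_imp_continuous_on[OF v] \<open>0 < r\<close> by (simp add: continuous_on_eq_continuous_at)
    from continuous_at_avoid[OF this \<open>v 0 \<noteq> 0\<close>] show thesis using that by blast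
  qed
  define \<rho> where "\<rho> = min d r"
  have \<rho>: "0 < \<rho>" "\<rho> \<le> r" "\<And>x. x \<in> ball 0 \<rho> \<Longrightarrow> v x \<noteq> 0"
    using d \<open>0 < r\<close> by (auto simp: \<rho>_def)
  have v': "v holomorphic_on ball 0 \<rho>" by (rule holomorphic_on_subset[OF v]) (use \<rho>(2) in auto)
  obtain g where g: "g holomorphic_on ball 0 \<rho>" "\<And>x. x \<in> ball 0 \<rho> \<Longrightarrow> v x = exp (g x)"
    by (rule contractible_imp_holomorphic_log[OF v' convex_imp_contractible[OF convex_ball]])
      (use \<rho>(3) that in blast)+
  define s where "s x = x * exp (g x / of_nat (2 * m + 1))" for x
  have s: "s holomorphic_on ball 0 \<rho>"
    unfolding s_def by (intro holomorphic_intros g) (simp add: of_nat_eq_0_iff)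
  have spow: "s x ^ (2 * m + 1) = x ^ (2 * m + 1) * v x" if "x \<in> ball 0 \<rho>" for x
  proof -
    have "exp (g x / of_nat (2 * m + 1)) ^ (2 * m + 1) = exp (of_nat (2 * m + 1) * (g x / of_nat (2 * m + 1)))"
      by (rule exp_of_nat_mult[symmetric])
    also have "\<dots> = v x" using g(2)[OF that] by (simp del: of_nat_add of_nat_Suc of_nat_mult)
    finally show ?thesis by (simp only: s_def power_mult_distrib)
  qed
  \<comment> \<open>The derivative is nonzero, so \<open>s\<close> is a coordinate near the origin.\<close>
  have "deriv s 0 = exp (g 0 / of_nat (2 * m + 1))"
  proof (rule DERIV_imp_deriv)
    have "((\<lambda>x. exp (g x / of_nat (2 * m + 1))) has_field_derivative
        deriv (\<lambda>x. exp (g x / of_nat (2 * m + 1))) 0) (at 0)"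
      by (rule holomorphic_derivI[of _ "ball 0 \<rho>"])
        (use \<rho>(1) in \<open>auto intro!: holomorphic_intros g simp: of_nat_eq_0_iff\<close>)
    from DERIV_mult[OF DERIV_ident this]
    show "(s has_field_derivative exp (g 0 / of_nat (2 * m + 1))) (at 0)"
      by (simp add: s_def[abs_def])
  qed
  then have s0: "deriv s 0 \<noteq> 0" by simp
  have "0 \<in> ball 0 \<rho>" using \<rho>(1) by simp
  obtain \<delta> where \<delta>: "0 < \<delta>" "ball (0::complex) \<delta> \<subseteq> ball 0 \<rho>" "inj_on s (ball 0 \<delta>)"
    by (rule has_complex_derivative_locally_injective[OF s \<open>0 \<in> ball 0 \<rho>\<close> open_ball s0])
  have "\<delta> \<le> \<rho>" using \<delta>(1,2) \<rho>(1) by (simp add: ball_subset_ball_iff)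
  define b where "b x = x ^ (m + 1) * \<beta> x / (2 * \<alpha> x)" for x
  show thesis
  proof (rule that[of \<delta> s b])
    show "0 < \<delta>" "\<delta> \<le> r" "inj_on s (ball 0 \<delta>)" using \<delta> \<open>\<delta> \<le> \<rho>\<close> \<rho>(2) by auto
    show "s holomorphic_on ball 0 \<delta>" using s \<delta>(2) by (rule holomorphic_on_subset)
    show "s 0 = 0" "b 0 = 0" by (auto simp: s_def b_def)
    have r: "ball 0 \<delta> \<subseteq> ball (0::complex) r" using \<open>\<delta> \<le> \<rho>\<close> \<rho>(2) by auto
    have nz': "\<alpha> x \<noteq> 0" if "x \<in> ball 0 \<delta>" for x using nz r that by blast
    show "b holomorphic_on ball 0 \<delta>"
      unfolding b_def
      by (intro holomorphic_intros holomorphic_on_subset[OF hol(1) r] holomorphic_on_subset[OF hol(2) r])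
        (use nz' in auto)
    fix x w :: complex assume x: "x \<in> ball 0 \<delta>"
    then have "x \<in> ball 0 \<rho>" using \<delta>(2) by blast
    note sp = spow[OF this]
    show "x ^ (2 * m + 1) + x ^ (m + 1) * \<beta> x * w + \<alpha> x * w ^ 2 =
      \<alpha> x * ((w + b x) ^ 2 - s x ^ (2 * m + 1))"
      unfolding sp v_def b_def using nz'[OF x]
      by (simp add: field_simps power2_eq_square power_mult power_add flip: mult_2)
  qed
qed

section \<open>Local coordinates on a complex surface\<close>

text \<open>Injectivity of the charts appears as an assumption because an atlas of a surface is an arbitrary set of
pairs; the atlas of the compactified cotangent bundle has it.\<close>

lemma open_in_Int:
  assumes inj: "\<And>M \<kappa>. (M, \<kappa>) \<in> S \<Longrightarrow> inj_on \<kappa> M" and "open_in S A" "open_in S B"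
  shows "open_in S (A \<inter> B)"
  unfolding open_in_def
proof (intro conjI ballI)
  show "A \<inter> B \<subseteq> points S" using assms(2) unfolding open_in_def by blast
  fix x assume x: "x \<in> S"
  obtain M \<kappa> where M: "x = (M, \<kappa>)" by (cases x)
  have "open (\<kappa> ` (M \<inter> A))" "open (\<kappa> ` (M \<inter> B))" using x M assms(2,3) by (auto simp: open_in_def)
  moreover have "\<kappa> ` (M \<inter> (A \<inter> B)) = \<kappa> ` (M \<inter> A) \<inter> \<kappa> ` (M \<inter> B)"
    using inj[of M \<kappa>] x M inj_on_image_Int[of \<kappa> M "M \<inter> A" "M \<inter> B"] by (simp add: Int_ac)
  ultimately show "case x of (M, \<kappa>) \<Rightarrow> open (\<kappa> ` (M \<inter> (A \<inter> B)))"
    by (simp add: M open_Int)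
qed

lemma holo_on_subset: "holo_on S f N \<Longrightarrow> N' \<subseteq> N \<Longrightarrow> holo_on S f N'"
  unfolding holo_on_def by (fastforce elim: holo2_on_subset)

lemma open_holo2_preimage:
  assumes "open A" "holo2_on p A" "holo2_on q A" "open W"
  shows "open {z \<in> A. (p z, q z) \<in> W}"
proof -
  have "continuous_on A (\<lambda>z. (p z, q z))"
    by (intro continuous_intros holo2_on_imp_continuous_on assms)
  from continuous_open_preimage[OF this assms(1,4)]
  have "open (A \<inter> (\<lambda>z. (p z, q z)) -` W)" .
  moreover have "{z \<in> A. (p z, q z) \<in> W} = A \<inter> (\<lambda>z. (p z, q z)) -` W" by auto
  ultimately show ?thesis by (simp only:)
qed

context
  fixes S :: "'s surface" and N :: "'s set" and \<psi> :: "'s \<Rightarrow> complex \<times> complex"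
  assumes inj: "\<And>M \<kappa>. (M, \<kappa>) \<in> S \<Longrightarrow> inj_on \<kappa> M" and \<psi>: "local_coords2 S N \<psi>"
begin

lemma coords_transition:
  assumes "(M, \<kappa>) \<in> S"
  shows "open (\<kappa> ` (M \<inter> N))" "open (\<psi> ` (M \<inter> N))"
    "holo2_on (\<lambda>z. fst (\<psi> (inv_into M \<kappa> z))) (\<kappa> ` (M \<inter> N))"
    "holo2_on (\<lambda>z. snd (\<psi> (inv_into M \<kappa> z))) (\<kappa> ` (M \<inter> N))"
    "holo2_on (\<lambda>z. fst (\<kappa> (inv_into N \<psi> z))) (\<psi> ` (M \<inter> N))"
    "holo2_on (\<lambda>z. snd (\<kappa> (inv_into N \<psi> z))) (\<psi> ` (M \<inter> N))"
  using assms \<psi> unfolding local_coords2_def open_in_def holo_on_def by (auto simp: split_beta)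

lemma inj_coords: "inj_on \<psi> N" and open_in_coords: "open_in S N"
  using \<psi> by (auto simp: local_coords2_def)

lemma chart_image_coords_preimage:
  assumes "(M, \<kappa>) \<in> S"
  shows "\<kappa> ` (M \<inter> {Q \<in> N. \<psi> Q \<in> W}) =
    {z \<in> \<kappa> ` (M \<inter> N). (fst (\<psi> (inv_into M \<kappa> z)), snd (\<psi> (inv_into M \<kappa> z))) \<in> W}"
  using inj[OF assms] by (auto simp: inv_into_f_f)

lemma open_in_coords_preimage:
  assumes "open W"
  shows "open_in S {Q \<in> N. \<psi> Q \<in> W}"
  unfolding open_in_def
proof (intro conjI ballI)
  show "{Q \<in> N. \<psi> Q \<in> W} \<subseteq> points S" using open_in_coords by (auto simp: open_in_def)
  fix c assume "c \<in> S"
  moreover obtain M \<kappa> where c: "c = (M, \<kappa>)" by (cases c)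
  ultimately have M: "(M, \<kappa>) \<in> S" by simp
  show "case c of (M, \<kappa>) \<Rightarrow> open (\<kappa> ` (M \<inter> {Q \<in> N. \<psi> Q \<in> W}))"
    unfolding c prod.case chart_image_coords_preimage[OF M]
    by (rule open_holo2_preimage) (rule coords_transition[OF M] assms)+
qed

lemma holo_on_coords_compose:
  assumes f: "holo2_on f W"
  shows "holo_on S (\<lambda>Q. f (\<psi> Q)) {Q \<in> N. \<psi> Q \<in> W}"
  unfolding holo_on_def
proof
  fix c assume "c \<in> S"
  moreover obtain M \<kappa> where c: "c = (M, \<kappa>)" by (cases c)
  ultimately have M: "(M, \<kappa>) \<in> S" by simp
  have "holo2_on (\<lambda>z. f (fst (\<psi> (inv_into M \<kappa> z)), snd (\<psi> (inv_into M \<kappa> z))))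
      (\<kappa> ` (M \<inter> {Q \<in> N. \<psi> Q \<in> W}))"
    unfolding chart_image_coords_preimage[OF M]
    by (rule holo2_on_compose[OF f]) (auto intro: holo2_on_subset[OF coords_transition(3)[OF M]]
        holo2_on_subset[OF coords_transition(4)[OF M]])
  then show "case c of (M, \<kappa>) \<Rightarrow>
      holo2_on (\<lambda>z. f (\<psi> (inv_into M \<kappa> z))) (\<kappa> ` (M \<inter> {Q \<in> N. \<psi> Q \<in> W}))"
    by (simp add: c)
qed

text \<open>Openness and holomorphy are defined by means of the charts of the surface; each point of the
set has a neighbourhood on which \<open>\<psi>\<close> can be compared with one of these.\<close>

lemma coords_image_open_in:
  assumes "open_in S N'" "N' \<subseteq> N"
  shows "open (\<psi> ` N')"
    and "holo_on S f N' \<Longrightarrow> holo2_on (\<lambda>z. f (inv_into N \<psi> z)) (\<psi> ` N')"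
proof -
  have *: "\<exists>B. open B \<and> \<psi> Q \<in> B \<and> B \<subseteq> \<psi> ` N' \<and>
      (holo_on S f N' \<longrightarrow> holo2_on (\<lambda>z. f (inv_into N \<psi> z)) B)" if Q: "Q \<in> N'" for Q
  proof -
    have "Q \<in> points S" using Q assms(1) unfolding open_in_def by blast
    then obtain c where "c \<in> S" "Q \<in> fst c" unfolding points_def by blast
    then obtain M \<kappa> where M: "(M, \<kappa>) \<in> S" "Q \<in> M" by (cases c) auto
    note tr = coords_transition[OF M(1)]
    define B where "B = {z \<in> \<psi> ` (M \<inter> N).
      (fst (\<kappa> (inv_into N \<psi> z)), snd (\<kappa> (inv_into N \<psi> z))) \<in> \<kappa> ` (M \<inter> N')}"
    have "open (\<kappa> ` (M \<inter> N'))" using assms(1) M(1) by (auto simp: open_in_def)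
    then have "open B" unfolding B_def by (rule open_holo2_preimage[OF tr(2,5,6)])
    moreover have "\<psi> Q \<in> B"
      using Q M(2) assms(2) inj_coords by (auto simp: B_def inv_into_f_f subset_iff)
    moreover have BN: "\<exists>R\<in>M \<inter> N'. z = \<psi> R" if "z \<in> B" for z
    proof -
      obtain R R' where R: "R \<in> M" "R \<in> N" "z = \<psi> R" "R' \<in> M" "R' \<in> N'" "\<kappa> R = \<kappa> R'"
        using \<open>z \<in> B\<close> inj_coords by (auto simp: B_def inv_into_f_f)
      then have "R = R'" using inj[OF M(1)] by (meson inj_onD)
      then show ?thesis using R by auto
    qed
    moreover have "holo2_on (\<lambda>z. f (inv_into N \<psi> z)) B" if f: "holo_on S f N'"
    proof (rule holo2_on_cong[OF \<open>open B\<close>])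
      have "holo2_on (\<lambda>z. f (inv_into M \<kappa> z)) (\<kappa> ` (M \<inter> N'))"
        using f M(1) by (auto simp: holo_on_def)
      then show "holo2_on (\<lambda>z. f (inv_into M \<kappa>
          (fst (\<kappa> (inv_into N \<psi> z)), snd (\<kappa> (inv_into N \<psi> z))))) B"
        by (rule holo2_on_compose) (auto simp: B_def intro: holo2_on_subset[OF tr(5)]
            holo2_on_subset[OF tr(6)])
      fix z assume "z \<in> B"
      then obtain R where "R \<in> M" "R \<in> N'" "z = \<psi> R" using BN by blast
      then show "f (inv_into M \<kappa> (fst (\<kappa> (inv_into N \<psi> z)), snd (\<kappa> (inv_into N \<psi> z)))) =
          f (inv_into N \<psi> z)"
        using assms(2) inj_coords inj[OF M(1)] by (auto simp: inv_into_f_f subset_iff)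
    qed
    ultimately show ?thesis by blast
  qed
  show "open (\<psi> ` N')"
  proof (subst open_subopen, rule ballI)
    fix z assume "z \<in> \<psi> ` N'"
    then obtain Q where "Q \<in> N'" "z = \<psi> Q" by blast
    with *[OF this(1)] show "\<exists>T. open T \<and> z \<in> T \<and> T \<subseteq> \<psi> ` N'" by metis
  qed
  show "holo2_on (\<lambda>z. f (inv_into N \<psi> z)) (\<psi> ` N')" if f: "holo_on S f N'"
  proof (rule holo2_on_local)
    fix z assume "z \<in> \<psi> ` N'"
    then obtain Q where "Q \<in> N'" "z = \<psi> Q" by blast
    with *[OF this(1)] f show "\<exists>V. z \<in> V \<and> holo2_on (\<lambda>z. f (inv_into N \<psi> z)) V" by metis
  qed
qed

text \<open>Composing local coordinates with a biholomorphic map of open sets, given together with its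
inverse, yields local coordinates.\<close>

lemma local_coords2_change:
  assumes W: "open W" "W \<subseteq> \<psi> ` N"
    and \<theta>: "holo2_on (\<lambda>z. fst (\<theta> z)) W" "holo2_on (\<lambda>z. snd (\<theta> z)) W"
    and V: "open V" "\<theta> ` W \<subseteq> V"
    and \<theta>': "holo2_on (\<lambda>z. fst (\<theta>' z)) V" "holo2_on (\<lambda>z. snd (\<theta>' z)) V"
    and inv: "\<And>z. z \<in> W \<Longrightarrow> \<theta>' (\<theta> z) = z" "\<And>z. z \<in> V \<Longrightarrow> \<theta> (\<theta>' z) = z"
  shows "local_coords2 S {Q \<in> N. \<psi> Q \<in> W} (\<lambda>Q. \<theta> (\<psi> Q))"
proof -
  let ?N = "{Q \<in> N. \<psi> Q \<in> W}"
  have injW: "inj_on (\<lambda>Q. \<theta> (\<psi> Q)) ?N"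
  proof (rule inj_onI)
    fix Q R assume "Q \<in> ?N" "R \<in> ?N" "\<theta> (\<psi> Q) = \<theta> (\<psi> R)"
    then have "\<psi> Q = \<psi> R" using inv(1) by (metis (mono_tags, lifting) mem_Collect_eq)
    then show "Q = R" using inj_coords \<open>Q \<in> ?N\<close> \<open>R \<in> ?N\<close> by (auto dest: inj_onD)
  qed
  have img: "(\<lambda>Q. \<theta> (\<psi> Q)) ` (M \<inter> ?N) =
      {z \<in> V. (fst (\<theta>' z), snd (\<theta>' z)) \<in> \<psi> ` (M \<inter> N) \<inter> W}" for M
  proof (intro equalityI subsetI)
    fix z assume "z \<in> {z \<in> V. (fst (\<theta>' z), snd (\<theta>' z)) \<in> \<psi> ` (M \<inter> N) \<inter> W}"
    then obtain Q where "z \<in> V" "Q \<in> M \<inter> N" "\<theta>' z = \<psi> Q" "\<psi> Q \<in> W" by auto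
    then show "z \<in> (\<lambda>Q. \<theta> (\<psi> Q)) ` (M \<inter> ?N)" using inv(2)[of z] by (intro image_eqI[of _ _ Q]) auto
  next
    fix z assume "z \<in> (\<lambda>Q. \<theta> (\<psi> Q)) ` (M \<inter> ?N)"
    then obtain Q where Q: "Q \<in> M" "Q \<in> N" "\<psi> Q \<in> W" "z = \<theta> (\<psi> Q)" by blast
    then have "\<theta>' z = \<psi> Q" "z \<in> V" using inv(1)[of "\<psi> Q"] V(2) by auto
    with Q show "z \<in> {z \<in> V. (fst (\<theta>' z), snd (\<theta>' z)) \<in> \<psi> ` (M \<inter> N) \<inter> W}" by auto
  qed
  have opn: "open ((\<lambda>Q. \<theta> (\<psi> Q)) ` (M \<inter> ?N))" if "open (\<psi> ` (M \<inter> N))" for M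
    unfolding img by (rule open_holo2_preimage[OF V(1) \<theta>']) (use that W(1) in auto)
  have o: "open_in S ?N" by (rule open_in_coords_preimage[OF W(1)])
  have invN: "inv_into ?N (\<lambda>Q. \<theta> (\<psi> Q)) z = inv_into N \<psi> (fst (\<theta>' z), snd (\<theta>' z))"
    if z: "z \<in> (\<lambda>Q. \<theta> (\<psi> Q)) ` ?N" for z
  proof -
    obtain Q where "Q \<in> ?N" "z = \<theta> (\<psi> Q)" using z by blast
    then show ?thesis using inv_into_f_f[OF injW] inv_into_f_f[OF inj_coords] inv(1) by auto
  qed
  have sub: "(\<lambda>Q. \<theta> (\<psi> Q)) ` (M \<inter> ?N) \<subseteq> V" for M using V(2) by auto
  have tr: "holo2_on (\<lambda>z. f (inv_into ?N (\<lambda>Q. \<theta> (\<psi> Q)) z)) ((\<lambda>Q. \<theta> (\<psi> Q)) ` (M \<inter> ?N))"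
    if f: "holo2_on (\<lambda>z. f (inv_into N \<psi> z)) (\<psi> ` (M \<inter> N))" "open (\<psi> ` (M \<inter> N))"
    for f :: "'s \<Rightarrow> complex" and M
  proof (rule holo2_on_cong[OF opn[OF f(2)]])
    show "holo2_on (\<lambda>z. f (inv_into N \<psi> (fst (\<theta>' z), snd (\<theta>' z)))) ((\<lambda>Q. \<theta> (\<psi> Q)) ` (M \<inter> ?N))"
      by (rule holo2_on_compose[OF f(1)])
        (auto simp: img intro: holo2_on_subset[OF \<theta>'(1)] holo2_on_subset[OF \<theta>'(2)])
    fix z assume "z \<in> (\<lambda>Q. \<theta> (\<psi> Q)) ` (M \<inter> ?N)"
    then have "z \<in> (\<lambda>Q. \<theta> (\<psi> Q)) ` ?N" by blast
    from invN[OF this] show "f (inv_into N \<psi> (fst (\<theta>' z), snd (\<theta>' z))) =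
        f (inv_into ?N (\<lambda>Q. \<theta> (\<psi> Q)) z)" by (simp only:)
  qed
  show ?thesis
    unfolding local_coords2_def
  proof (intro conjI o injW)
    have "N \<inter> ?N = ?N" by auto
    then show "open ((\<lambda>Q. \<theta> (\<psi> Q)) ` ?N)"
      using opn[of N] \<psi> by (simp add: local_coords2_def)
    show "holo_on S (\<lambda>Q. fst (\<theta> (\<psi> Q))) ?N" "holo_on S (\<lambda>Q. snd (\<theta> (\<psi> Q))) ?N"
      using holo_on_coords_compose[OF \<theta>(1)] holo_on_coords_compose[OF \<theta>(2)] by auto
    show "\<forall>(M, \<kappa>)\<in>S. open ((\<lambda>Q. \<theta> (\<psi> Q)) ` (M \<inter> ?N)) \<and>
        holo2_on (\<lambda>z. fst (\<kappa> (inv_into ?N (\<lambda>Q. \<theta> (\<psi> Q)) z))) ((\<lambda>Q. \<theta> (\<psi> Q)) ` (M \<inter> ?N)) \<and>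
        holo2_on (\<lambda>z. snd (\<kappa> (inv_into ?N (\<lambda>Q. \<theta> (\<psi> Q)) z))) ((\<lambda>Q. \<theta> (\<psi> Q)) ` (M \<inter> ?N))"
    proof (rule ballI, rule case_prodI2, intro conjI)
      fix c M \<kappa> assume "c \<in> S" "c = (M, \<kappa>)"
      then have "(M, \<kappa>) \<in> S" by simp
      note t = coords_transition[OF this]
      show "open ((\<lambda>Q. \<theta> (\<psi> Q)) ` (M \<inter> ?N))" by (rule opn[OF t(2)])
      show "holo2_on (\<lambda>z. fst (\<kappa> (inv_into ?N (\<lambda>Q. \<theta> (\<psi> Q)) z))) ((\<lambda>Q. \<theta> (\<psi> Q)) ` (M \<inter> ?N))"
        by (rule tr[OF t(5,2)])
      show "holo2_on (\<lambda>z. snd (\<kappa> (inv_into ?N (\<lambda>Q. \<theta> (\<psi> Q)) z))) ((\<lambda>Q. \<theta> (\<psi> Q)) ` (M \<inter> ?N))"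
        by (rule tr[OF t(6,2)])
    qed
  qed
qed

end

section \<open>Coordinates and cotangent vectors on a curve\<close>

lemma atlas_subset_local_coords: "riemann_surface C \<Longrightarrow> atlas C \<subseteq> local_coords C"
  by (auto simp: riemann_surface_def local_coords_def)

lemma local_coords_openin: "c \<in> local_coords C \<Longrightarrow> openin (ctop C) (fst c)"
  by (auto simp: local_coords_def is_chart_def)

lemma local_coords_inj:
  assumes "c \<in> local_coords C"
  shows "inj_on (snd c) (fst c)"
proof -
  have "fst c \<subseteq> topspace (ctop C)" using local_coords_openin[OF assms] openin_subset by blast
  moreover have "homeomorphic_map (subtopology (ctop C) (fst c)) (top_of_set (snd c ` fst c)) (snd c)"
    using assms by (auto simp: local_coords_def is_chart_def)
  ultimately show ?thesis
    using homeomorphic_imp_injective_map by (metis topspace_subtopology_subset)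
qed

lemma local_coords_open_image:
  assumes c: "c \<in> local_coords C" and V: "openin (ctop C) V"
  shows "open (snd c ` (fst c \<inter> V))"
proof -
  have "homeomorphic_map (subtopology (ctop C) (fst c)) (top_of_set (snd c ` fst c)) (snd c)"
    "open (snd c ` fst c)"
    using c by (auto simp: local_coords_def is_chart_def)
  moreover have "openin (subtopology (ctop C) (fst c)) (fst c \<inter> V)"
    using V by (rule openin_subtopology_Int2)
  ultimately have "openin (top_of_set (snd c ` fst c)) (snd c ` (fst c \<inter> V))"
    using homeomorphic_imp_open_map unfolding open_map_def by blast
  then show ?thesis using \<open>open (snd c ` fst c)\<close> openin_open_eq by blast
qed

lemma in_coord_apply:
  "c \<in> local_coords C \<Longrightarrow> p \<in> fst c \<Longrightarrow> in_coord c f (snd c p) = f p"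
  using local_coords_inj by (fastforce simp: in_coord_def)

context
  fixes C :: "'a curve"
  assumes C: "riemann_surface C"
begin

text \<open>Two local coordinates are required to be compatible with the atlas only.  They are compatible with each
other because near every point the transition map passes through a chart of the atlas.\<close>

lemma holomorphic_transition:
  assumes c: "c \<in> local_coords C" "c' \<in> local_coords C"
  shows "in_coord c (snd c') holomorphic_on snd c ` (fst c \<inter> fst c')"
proof -
  have o: "open (snd c ` (fst c \<inter> fst c'))"
    using local_coords_open_image[OF c(1) local_coords_openin[OF c(2)]] .
  have "\<exists>D. (in_coord c (snd c') has_field_derivative D) (at x)"
    if x: "x \<in> snd c ` (fst c \<inter> fst c')" for x
  proof -
    obtain p where p: "p \<in> fst c" "p \<in> fst c'" "x = snd c p" using x by blast
    have "p \<in> topspace (ctop C)" using p(1) local_coords_openin[OF c(1)] openin_subset by blast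
    then obtain d where d: "d \<in> atlas C" "p \<in> fst d" using C unfolding riemann_surface_def by blast
    have dl: "d \<in> local_coords C" using d(1) atlas_subset_local_coords[OF C] by blast
    let ?V = "fst c \<inter> (fst c' \<inter> fst d)"
    have oV: "open (snd c ` ?V)"
      by (rule local_coords_open_image[OF c(1)]) (intro openin_Int local_coords_openin[OF c(2)] local_coords_openin[OF dl])
    have "in_coord c (snd d) holomorphic_on snd c ` (fst c \<inter> fst d)"
      "in_coord d (snd c') holomorphic_on snd d ` (fst c' \<inter> fst d)"
      using c d(1) unfolding local_coords_def holo_compatible_def by (auto simp: Int_commute)
    then have "in_coord d (snd c') \<circ> in_coord c (snd d) holomorphic_on snd c ` ?V"
      by (intro holomorphic_on_compose_gen[of _ _ _ "snd d ` (fst c' \<inter> fst d)"])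
        (auto intro: holomorphic_on_subset simp: in_coord_apply[OF c(1)])
    then have "in_coord c (snd c') holomorphic_on snd c ` ?V"
      by (rule holomorphic_transform)
        (auto simp: in_coord_apply[OF c(1)] in_coord_apply[OF dl])
    moreover have "x \<in> snd c ` ?V" using p d by blast
    ultimately show ?thesis using oV holomorphic_derivI by blast
  qed
  then show ?thesis using o holomorphic_on_open by blast
qed

lemma open_overlap:
  assumes c: "c \<in> local_coords C" "c' \<in> local_coords C"
  shows "open (snd c ` (fst c \<inter> fst c'))"
  using local_coords_open_image[OF c(1) local_coords_openin[OF c(2)]] .

lemma has_coord_deriv:
  assumes c: "c \<in> local_coords C" "c' \<in> local_coords C" and p: "p \<in> fst c" "p \<in> fst c'"
  shows "(in_coord c (snd c') has_field_derivative coord_deriv c' c p) (at (snd c p))"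
  unfolding coord_deriv_def
  by (rule holomorphic_derivI[OF holomorphic_transition[OF c] open_overlap[OF c]]) (use p in blast)

lemma coord_deriv_chain:
  assumes c: "c \<in> local_coords C" "c' \<in> local_coords C" "c'' \<in> local_coords C"
    and p: "p \<in> fst c" "p \<in> fst c'" "p \<in> fst c''"
  shows "coord_deriv c'' c p = coord_deriv c'' c' p * coord_deriv c' c p"
proof -
  let ?V = "fst c \<inter> (fst c' \<inter> fst c'')"
  have oV: "open (snd c ` ?V)"
    by (rule local_coords_open_image[OF c(1)]) (intro openin_Int local_coords_openin[OF c(2)] local_coords_openin[OF c(3)])
  have "(in_coord c' (snd c'') has_field_derivative coord_deriv c'' c' p) (at (in_coord c (snd c') (snd c p)))"
    using has_coord_deriv[OF c(2,3) p(2,3)] by (simp add: in_coord_apply[OF c(1) p(1)])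
  from DERIV_chain[OF this has_coord_deriv[OF c(1,2) p(1,2)]]
  have "(in_coord c (snd c'') has_field_derivative coord_deriv c'' c' p * coord_deriv c' c p) (at (snd c p))"
    by (rule has_field_derivative_transform_within_open[OF _ oV])
      (use p in \<open>auto simp: in_coord_apply[OF c(1)] in_coord_apply[OF c(2)]\<close>)
  then show ?thesis using has_coord_deriv[OF c(1,3) p(1,3)] DERIV_unique by blast
qed

lemma coord_deriv_self:
  assumes c: "c \<in> local_coords C" and p: "p \<in> fst c"
  shows "coord_deriv c c p = 1"
proof -
  have "open (snd c ` fst c)" using open_overlap[OF c c] by simp
  then have "(in_coord c (snd c) has_field_derivative 1) (at (snd c p))"
    by (rule has_field_derivative_transform_within_open[OF DERIV_ident])
      (use p in \<open>auto simp: in_coord_apply[OF c]\<close>)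
  then show ?thesis using has_coord_deriv[OF c c p p] DERIV_unique by blast
qed

lemma coord_deriv_inverse:
  assumes c: "c \<in> local_coords C" "c' \<in> local_coords C" and p: "p \<in> fst c" "p \<in> fst c'"
  shows "coord_deriv c c' p * coord_deriv c' c p = 1"
  using coord_deriv_chain[OF c(1,2,1) p(1,2,1)] coord_deriv_self[OF c(1) p(1)] by simp

lemma cotangent_change:
  assumes "\<xi> \<in> cotangent_vectors C p" "c \<in> local_coords C" "c' \<in> local_coords C"
    "p \<in> fst c" "p \<in> fst c'"
  shows "\<xi> c = coord_deriv c' c p * \<xi> c'"
  using assms unfolding cotangent_vectors_def coords_at_def by blast

lemma cotangent_ext:
  assumes "\<xi> \<in> cotangent_vectors C p" "\<xi>' \<in> cotangent_vectors C p"
    and c: "c \<in> local_coords C" "p \<in> fst c" and eq: "\<xi> c = \<xi>' c"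
  shows "\<xi> = \<xi>'"
proof
  fix c'
  show "\<xi> c' = \<xi>' c'"
  proof (cases "c' \<in> coords_at C p")
    case True
    then show ?thesis
      using cotangent_change[OF assms(1), of c' c] cotangent_change[OF assms(2), of c' c] c eq
      by (auto simp: coords_at_def)
  next
    case False
    then have "\<xi> c' = 0" "\<xi>' c' = 0" using assms(1,2) unfolding cotangent_vectors_def by blast+
    then show ?thesis by simp
  qed
qed

text \<open>The chain rule makes the prescription of a single coefficient consistent.\<close>

lemma cotangent_exists:
  assumes c: "c \<in> local_coords C" "p \<in> fst c"
  obtains \<xi> where "\<xi> \<in> cotangent_vectors C p" "\<xi> c = y"
proof
  let ?\<xi> = "\<lambda>c'. if c' \<in> coords_at C p then coord_deriv c c' p * y else 0"
  show "?\<xi> \<in> cotangent_vectors C p"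
    unfolding cotangent_vectors_def
  proof (intro CollectI conjI ballI allI impI)
    fix c1 c2 assume c12: "c1 \<in> coords_at C p" "c2 \<in> coords_at C p"
    then have "coord_deriv c c1 p = coord_deriv c c2 p * coord_deriv c2 c1 p"
      using c by (intro coord_deriv_chain) (auto simp: coords_at_def)
    then show "?\<xi> c1 = coord_deriv c2 c1 p * ?\<xi> c2" using c12 by simp
  qed simp
  show "?\<xi> c = y" using c coord_deriv_self by (simp add: coords_at_def)
qed

section \<open>Charts at infinity of the compactified cotangent bundle\<close>

lemma infinity_chart_cases:
  assumes "Q \<in> fst (infinity_chart C c)"
  obtains (Cov) p \<xi> where "Q = Cov p \<xi>" "p \<in> fst c" "\<xi> \<in> cotangent_vectors C p" "\<xi> c \<noteq> 0"
      "snd (infinity_chart C c) Q = (snd c p, 1 / \<xi> c)"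
    | (AtInf) p where "Q = AtInf p" "p \<in> fst c" "snd (infinity_chart C c) Q = (snd c p, 0)"
  using assms by (auto simp: infinity_chart_def)

lemma affine_chart_cases:
  assumes "Q \<in> fst (affine_chart C c)"
  obtains p \<xi> where "Q = Cov p \<xi>" "p \<in> fst c" "\<xi> \<in> cotangent_vectors C p"
      "snd (affine_chart C c) Q = (snd c p, \<xi> c)"
  using assms by (auto simp: affine_chart_def)

lemma infinity_chart_proj:
  assumes "Q \<in> fst (infinity_chart C c)"
  shows "proj Q \<in> fst c" "fst (snd (infinity_chart C c) Q) = snd c (proj Q)"
  using infinity_chart_cases[OF assms] by (metis fst_conv proj.simps)+

lemma inj_infinity_chart:
  assumes c: "c \<in> local_coords C"
  shows "inj_on (snd (infinity_chart C c)) (fst (infinity_chart C c))"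
proof (rule inj_onI)
  fix Q R assume QR: "Q \<in> fst (infinity_chart C c)" "R \<in> fst (infinity_chart C c)"
    and eq: "snd (infinity_chart C c) Q = snd (infinity_chart C c) R"
  have p: "proj Q = proj R"
    using infinity_chart_proj[OF QR(1)] infinity_chart_proj[OF QR(2)] eq local_coords_inj[OF c]
    by (metis inj_onD)
  show "Q = R"
    by (rule infinity_chart_cases[OF QR(1)]; rule infinity_chart_cases[OF QR(2)])
      (use p eq cotangent_ext[OF _ _ c] in auto)
qed

lemma inj_affine_chart:
  assumes c: "c \<in> local_coords C"
  shows "inj_on (snd (affine_chart C c)) (fst (affine_chart C c))"
proof (rule inj_onI)
  fix Q R assume QR: "Q \<in> fst (affine_chart C c)" "R \<in> fst (affine_chart C c)"
    and eq: "snd (affine_chart C c) Q = snd (affine_chart C c) R"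
  obtain p \<xi> where 1: "Q = Cov p \<xi>" "p \<in> fst c" "\<xi> \<in> cotangent_vectors C p"
      "snd (affine_chart C c) Q = (snd c p, \<xi> c)" by (rule affine_chart_cases[OF QR(1)])
  obtain q \<xi>' where 2: "R = Cov q \<xi>'" "q \<in> fst c" "\<xi>' \<in> cotangent_vectors C q"
      "snd (affine_chart C c) R = (snd c q, \<xi>' c)" by (rule affine_chart_cases[OF QR(2)])
  have "p = q" using 1 2 eq local_coords_inj[OF c] by (auto dest: inj_onD)
  then show "Q = R" using 1 2 eq cotangent_ext[OF _ _ c] by auto
qed

lemma inj_Tbar_chart: "(M, \<kappa>) \<in> Tbar C \<Longrightarrow> inj_on \<kappa> M"
  using inj_infinity_chart inj_affine_chart unfolding Tbar_def by (auto simp: image_iff) (metis fst_conv snd_conv)+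

text \<open>Since \<open>y = (dx'/dx) y'\<close>, the coordinate \<open>w = 1/y\<close> transforms by \<open>w' = (dx'/dx) w\<close>.\<close>

lemma infinity_infinity_overlap:
  assumes c: "c \<in> local_coords C" "c' \<in> local_coords C"
    and Q: "Q \<in> fst (infinity_chart C c)" "proj Q \<in> fst c'"
  shows "Q \<in> fst (infinity_chart C c')"
    and "snd (infinity_chart C c') Q =
      (in_coord c (snd c') (fst (snd (infinity_chart C c) Q)),
       deriv (in_coord c (snd c')) (fst (snd (infinity_chart C c) Q)) * snd (snd (infinity_chart C c) Q))"
proof (atomize(full), cases rule: infinity_chart_cases[OF Q(1)])
  case (1 p \<xi>)
  have p: "p \<in> fst c'" using Q(2) 1 by simp
  have e: "\<xi> c = coord_deriv c' c p * \<xi> c'" by (rule cotangent_change) (use 1 p c in auto)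
  have "\<xi> c' \<noteq> 0" using e 1 by auto
  with 1 p e show "Q \<in> fst (infinity_chart C c') \<and> snd (infinity_chart C c') Q =
      (in_coord c (snd c') (fst (snd (infinity_chart C c) Q)),
       deriv (in_coord c (snd c')) (fst (snd (infinity_chart C c) Q)) * snd (snd (infinity_chart C c) Q))"
    by (simp add: infinity_chart_def in_coord_apply[OF c(1)] coord_deriv_def)
next
  case (2 p)
  then show "Q \<in> fst (infinity_chart C c') \<and> snd (infinity_chart C c') Q =
      (in_coord c (snd c') (fst (snd (infinity_chart C c) Q)),
       deriv (in_coord c (snd c')) (fst (snd (infinity_chart C c) Q)) * snd (snd (infinity_chart C c) Q))"
    using Q(2) by (simp add: infinity_chart_def in_coord_apply[OF c(1)])
qed

lemma infinity_affine_overlap: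
  assumes c: "c \<in> local_coords C" "c' \<in> local_coords C"
    and Q: "Q \<in> fst (infinity_chart C c)" "Q \<in> fst (affine_chart C c')"
  shows "snd (affine_chart C c') Q =
      (in_coord c (snd c') (fst (snd (infinity_chart C c) Q)),
       inverse (deriv (in_coord c (snd c')) (fst (snd (infinity_chart C c) Q)) * snd (snd (infinity_chart C c) Q)))"
    and "snd (infinity_chart C c) Q =
      (in_coord c' (snd c) (fst (snd (affine_chart C c') Q)),
       deriv (in_coord c' (snd c)) (fst (snd (affine_chart C c') Q)) * inverse (snd (snd (affine_chart C c') Q)))"
    and "snd (snd (infinity_chart C c) Q) \<noteq> 0" "snd (snd (affine_chart C c') Q) \<noteq> 0"
    "proj Q \<in> fst c" "proj Q \<in> fst c'"
proof -
  obtain p \<xi> where 1: "Q = Cov p \<xi>" "p \<in> fst c'" "\<xi> \<in> cotangent_vectors C p"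
      "snd (affine_chart C c') Q = (snd c' p, \<xi> c')" by (rule affine_chart_cases[OF Q(2)])
  have 2: "p \<in> fst c" "\<xi> c \<noteq> 0" "snd (infinity_chart C c) Q = (snd c p, 1 / \<xi> c)"
    using Q(1) by (auto elim!: infinity_chart_cases simp: 1(1))
  have e: "\<xi> c = coord_deriv c' c p * \<xi> c'" "\<xi> c' = coord_deriv c c' p * \<xi> c"
    by (rule cotangent_change; use 1 2 c in simp)+
  have nz: "\<xi> c' \<noteq> 0" "coord_deriv c' c p \<noteq> 0" "coord_deriv c c' p \<noteq> 0" using e 2 by auto
  have d: "deriv (in_coord c (snd c')) (snd c p) = coord_deriv c' c p"
    "deriv (in_coord c' (snd c)) (snd c' p) = coord_deriv c c' p" by (auto simp: coord_deriv_def)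
  show "snd (affine_chart C c') Q =
      (in_coord c (snd c') (fst (snd (infinity_chart C c) Q)),
       inverse (deriv (in_coord c (snd c')) (fst (snd (infinity_chart C c) Q)) * snd (snd (infinity_chart C c) Q)))"
    using 1 2 nz by (simp add: in_coord_apply[OF c(1)] d e(1) field_simps)
  show "snd (infinity_chart C c) Q =
      (in_coord c' (snd c) (fst (snd (affine_chart C c') Q)),
       deriv (in_coord c' (snd c)) (fst (snd (affine_chart C c') Q)) * inverse (snd (snd (affine_chart C c') Q)))"
    using 1 2 nz by (simp add: in_coord_apply[OF c(2)] d e(2) field_simps)
  show "snd (snd (infinity_chart C c) Q) \<noteq> 0" "snd (snd (affine_chart C c') Q) \<noteq> 0"
    "proj Q \<in> fst c" "proj Q \<in> fst c'"
    using 1 2 nz by auto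
qed

lemma image_infinity_chart:
  assumes c: "c \<in> local_coords C" and V: "V \<subseteq> fst c"
  shows "snd (infinity_chart C c) ` {Q \<in> fst (infinity_chart C c). proj Q \<in> V} = snd c ` V \<times> (UNIV :: complex set)"
proof (intro equalityI subsetI)
  fix z assume "z \<in> snd c ` V \<times> (UNIV :: complex set)"
  then obtain p w where p: "p \<in> V" "z = (snd c p, w)" by auto
  show "z \<in> snd (infinity_chart C c) ` {Q \<in> fst (infinity_chart C c). proj Q \<in> V}"
  proof (cases "w = 0")
    case True
    then show ?thesis using p V by (intro image_eqI[of _ _ "AtInf p"]) (auto simp: infinity_chart_def)
  next
    case False
    obtain \<xi> where "\<xi> \<in> cotangent_vectors C p" "\<xi> c = 1 / w"
      using cotangent_exists[OF c, of p "1 / w"] p V by blast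
    then show ?thesis using p V False
      by (intro image_eqI[of _ _ "Cov p \<xi>"]) (auto simp: infinity_chart_def)
  qed
next
  fix z assume "z \<in> snd (infinity_chart C c) ` {Q \<in> fst (infinity_chart C c). proj Q \<in> V}"
  then obtain Q where "z = snd (infinity_chart C c) Q" "Q \<in> fst (infinity_chart C c)" "proj Q \<in> V"
    by blast
  then show "z \<in> snd c ` V \<times> (UNIV :: complex set)"
    using infinity_chart_proj(2)[of Q c] by (auto simp: mem_Times_iff)
qed

lemma image_infinity_affine:
  assumes c: "c \<in> local_coords C" "c' \<in> local_coords C"
  shows "snd (infinity_chart C c) ` (fst (infinity_chart C c) \<inter> fst (affine_chart C c')) =
      snd c ` (fst c \<inter> fst c') \<times> (- {0 :: complex})"
    and "snd (affine_chart C c') ` (fst (infinity_chart C c) \<inter> fst (affine_chart C c')) =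
      snd c' ` (fst c \<inter> fst c') \<times> (- {0 :: complex})"
proof -
  have fst: "fst (snd (infinity_chart C c) Q) = snd c (proj Q)" "fst (snd (affine_chart C c') Q) = snd c' (proj Q)"
    if Q: "Q \<in> fst (infinity_chart C c)" "Q \<in> fst (affine_chart C c')" for Q
  proof -
    show "fst (snd (infinity_chart C c) Q) = snd c (proj Q)" using infinity_chart_proj Q by blast
    show "fst (snd (affine_chart C c') Q) = snd c' (proj Q)"
      by (rule affine_chart_cases[OF Q(2)]) auto
  qed
  have sub: "snd (infinity_chart C c) Q \<in> snd c ` (fst c \<inter> fst c') \<times> (- {0 :: complex})"
    "snd (affine_chart C c') Q \<in> snd c' ` (fst c \<inter> fst c') \<times> (- {0 :: complex})"
    if Q: "Q \<in> fst (infinity_chart C c)" "Q \<in> fst (affine_chart C c')" for Q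
    using infinity_affine_overlap(3-6)[OF c Q] fst[OF Q] by (auto simp: mem_Times_iff)
  have ex: "\<exists>Q \<in> fst (infinity_chart C c) \<inter> fst (affine_chart C c').
      snd (infinity_chart C c) Q = (snd c p, 1 / y)"
    if p: "p \<in> fst c" "p \<in> fst c'" "y \<noteq> 0" for p y
  proof -
    obtain \<xi> where "\<xi> \<in> cotangent_vectors C p" "\<xi> c = y"
      using cotangent_exists[OF c(1), of p y] p by blast
    then show ?thesis using p
      by (intro bexI[of _ "Cov p \<xi>"]) (auto simp: infinity_chart_def affine_chart_def)
  qed
  have ex': "\<exists>Q \<in> fst (infinity_chart C c) \<inter> fst (affine_chart C c').
      snd (affine_chart C c') Q = (snd c' p, y)"
    if p: "p \<in> fst c" "p \<in> fst c'" "y \<noteq> 0" for p y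
  proof -
    obtain \<xi> where \<xi>: "\<xi> \<in> cotangent_vectors C p" "\<xi> c' = y"
      using cotangent_exists[OF c(2), of p y] p by blast
    have "\<xi> c' = coord_deriv c c' p * \<xi> c" by (rule cotangent_change) (use \<xi> p c in auto)
    then have "\<xi> c \<noteq> 0" using \<xi> p by auto
    then show ?thesis using p \<xi>
      by (intro bexI[of _ "Cov p \<xi>"]) (auto simp: infinity_chart_def affine_chart_def)
  qed
  show "snd (infinity_chart C c) ` (fst (infinity_chart C c) \<inter> fst (affine_chart C c')) =
      snd c ` (fst c \<inter> fst c') \<times> (- {0 :: complex})"
  proof (intro equalityI subsetI)
    fix z assume "z \<in> snd c ` (fst c \<inter> fst c') \<times> (- {0 :: complex})"
    then obtain p w where pw: "p \<in> fst c" "p \<in> fst c'" "w \<noteq> 0" "z = (snd c p, w)" by auto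
    from ex[OF pw(1,2), of "1 / w"] pw(3)
    obtain Q where "Q \<in> fst (infinity_chart C c) \<inter> fst (affine_chart C c')"
      "snd (infinity_chart C c) Q = (snd c p, w)" by auto
    then show "z \<in> snd (infinity_chart C c) ` (fst (infinity_chart C c) \<inter> fst (affine_chart C c'))"
      using pw(4) by (intro image_eqI[of _ _ Q]) simp_all
  qed (use sub(1) in blast)
  show "snd (affine_chart C c') ` (fst (infinity_chart C c) \<inter> fst (affine_chart C c')) =
      snd c' ` (fst c \<inter> fst c') \<times> (- {0 :: complex})"
  proof (intro equalityI subsetI)
    fix z assume "z \<in> snd c' ` (fst c \<inter> fst c') \<times> (- {0 :: complex})"
    then obtain p w where pw: "p \<in> fst c" "p \<in> fst c'" "w \<noteq> 0" "z = (snd c' p, w)" by auto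
    from ex'[OF pw(1,2,3)]
    obtain Q where "Q \<in> fst (infinity_chart C c) \<inter> fst (affine_chart C c')"
      "snd (affine_chart C c') Q = (snd c' p, w)" by auto
    then show "z \<in> snd (affine_chart C c') ` (fst (infinity_chart C c) \<inter> fst (affine_chart C c'))"
      using pw(4) by (intro image_eqI[of _ _ Q]) simp_all
  qed (use sub(2) in blast)
qed

lemma infinity_infinity_Int:
  assumes c: "c \<in> local_coords C" "c' \<in> local_coords C"
  shows "fst (infinity_chart C c) \<inter> fst (infinity_chart C c') =
    {Q \<in> fst (infinity_chart C c). proj Q \<in> fst c \<inter> fst c'}"
  using infinity_infinity_overlap(1)[OF c] infinity_chart_proj(1) by blast

end

lemma holo2_transition:
  assumes inj: "inj_on \<kappa> M" and A: "A \<subseteq> M" "open (\<kappa> ` A)"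
    and T: "holo2_on p (\<kappa> ` A)" "holo2_on q (\<kappa> ` A)"
    and eq: "\<And>Q. Q \<in> A \<Longrightarrow> \<psi> Q = (p (\<kappa> Q), q (\<kappa> Q))"
  shows "holo2_on (\<lambda>z. fst (\<psi> (inv_into M \<kappa> z))) (\<kappa> ` A)"
    "holo2_on (\<lambda>z. snd (\<psi> (inv_into M \<kappa> z))) (\<kappa> ` A)"
proof -
  have "inv_into M \<kappa> (\<kappa> Q) = Q" if "Q \<in> A" for Q using that A(1) inj by (auto intro: inv_into_f_f)
  then have e: "fst (\<psi> (inv_into M \<kappa> z)) = p z" "snd (\<psi> (inv_into M \<kappa> z)) = q z" if "z \<in> \<kappa> ` A" for z
    using eq that by auto
  show "holo2_on (\<lambda>z. fst (\<psi> (inv_into M \<kappa> z))) (\<kappa> ` A)"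
    by (rule holo2_on_cong[OF A(2) _ T(1)]) (simp add: e)
  show "holo2_on (\<lambda>z. snd (\<psi> (inv_into M \<kappa> z))) (\<kappa> ` A)"
    by (rule holo2_on_cong[OF A(2) _ T(2)]) (simp add: e)
qed

context
  fixes C :: "'a curve"
  assumes C: "riemann_surface C"
begin

lemma holo2_on_transition_fst:
  assumes c: "c \<in> local_coords C" "c' \<in> local_coords C"
  shows "holo2_on (\<lambda>z. in_coord c (snd c') (fst z)) (snd c ` (fst c \<inter> fst c') \<times> B)"
    "holo2_on (\<lambda>z. deriv (in_coord c (snd c')) (fst z)) (snd c ` (fst c \<inter> fst c') \<times> B)"
  using holo2_on_compose_holomorphic[OF holomorphic_transition[OF C c] open_overlap[OF C c] holo2_on_fst]
    holo2_on_compose_holomorphic[OF holomorphic_deriv[OF holomorphic_transition[OF C c] open_overlap[OF C c]]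
      open_overlap[OF C c] holo2_on_fst]
  by auto

lemma infinity_infinity_transition:
  assumes c: "c \<in> local_coords C" "c' \<in> local_coords C"
  defines "N \<equiv> fst (infinity_chart C c)" and "\<psi> \<equiv> snd (infinity_chart C c)"
    and "M \<equiv> fst (infinity_chart C c')" and "\<kappa> \<equiv> snd (infinity_chart C c')"
  shows "open (\<psi> ` (M \<inter> N))" "holo2_on (\<lambda>z. fst (\<kappa> (inv_into N \<psi> z))) (\<psi> ` (M \<inter> N))"
    "holo2_on (\<lambda>z. snd (\<kappa> (inv_into N \<psi> z))) (\<psi> ` (M \<inter> N))"
proof -
  have img: "\<psi> ` (M \<inter> N) = snd c ` (fst c \<inter> fst c') \<times> UNIV"
    using image_infinity_chart[OF C c(1), of "fst c \<inter> fst c'"] infinity_infinity_Int[OF C c]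
    by (simp add: N_def M_def \<psi>_def Int_commute)
  show o: "open (\<psi> ` (M \<inter> N))"
    unfolding img using open_overlap[OF C c] by (intro open_Times) auto
  have eq: "\<kappa> Q = (in_coord c (snd c') (fst (\<psi> Q)),
      deriv (in_coord c (snd c')) (fst (\<psi> Q)) * snd (\<psi> Q))" if "Q \<in> M \<inter> N" for Q
    using infinity_infinity_overlap(2)[OF C c, of Q] that infinity_chart_proj(1)[OF C, of Q c']
    by (simp add: N_def M_def \<psi>_def \<kappa>_def)
  have inj: "inj_on \<psi> N" unfolding \<psi>_def N_def by (rule inj_infinity_chart[OF C c(1)])
  have h: "holo2_on (\<lambda>z. in_coord c (snd c') (fst z)) (\<psi> ` (M \<inter> N))"
    "holo2_on (\<lambda>z. deriv (in_coord c (snd c')) (fst z) * snd z) (\<psi> ` (M \<inter> N))"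
    unfolding img by (intro holo2_on_transition_fst[OF c] holo2_intros)+
  show "holo2_on (\<lambda>z. fst (\<kappa> (inv_into N \<psi> z))) (\<psi> ` (M \<inter> N))"
    "holo2_on (\<lambda>z. snd (\<kappa> (inv_into N \<psi> z))) (\<psi> ` (M \<inter> N))"
    by (rule holo2_transition[OF inj Int_lower2 o h eq]; simp)+
qed

lemma infinity_affine_transition:
  assumes c: "c \<in> local_coords C" "c' \<in> local_coords C"
  defines "N \<equiv> fst (infinity_chart C c)" and "\<psi> \<equiv> snd (infinity_chart C c)"
    and "M \<equiv> fst (affine_chart C c')" and "\<kappa> \<equiv> snd (affine_chart C c')"
  shows "open (\<psi> ` (M \<inter> N))" "holo2_on (\<lambda>z. fst (\<kappa> (inv_into N \<psi> z))) (\<psi> ` (M \<inter> N))"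
    "holo2_on (\<lambda>z. snd (\<kappa> (inv_into N \<psi> z))) (\<psi> ` (M \<inter> N))"
    "open (\<kappa> ` (M \<inter> N))" "holo2_on (\<lambda>z. fst (\<psi> (inv_into M \<kappa> z))) (\<kappa> ` (M \<inter> N))"
    "holo2_on (\<lambda>z. snd (\<psi> (inv_into M \<kappa> z))) (\<kappa> ` (M \<inter> N))"
proof -
  have img: "\<psi> ` (M \<inter> N) = snd c ` (fst c \<inter> fst c') \<times> (- {0 :: complex})"
    "\<kappa> ` (M \<inter> N) = snd c' ` (fst c' \<inter> fst c) \<times> (- {0 :: complex})"
    using image_infinity_affine[OF C c]
    by (simp_all add: N_def M_def \<psi>_def \<kappa>_def Int_commute)
  show o: "open (\<psi> ` (M \<inter> N))" "open (\<kappa> ` (M \<inter> N))"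
    unfolding img using open_overlap[OF C c] open_overlap[OF C c(2,1)] by (auto intro!: open_Times)
  have eq: "\<kappa> Q = (in_coord c (snd c') (fst (\<psi> Q)),
      inverse (deriv (in_coord c (snd c')) (fst (\<psi> Q)) * snd (\<psi> Q)))"
    "\<psi> Q = (in_coord c' (snd c) (fst (\<kappa> Q)),
      deriv (in_coord c' (snd c)) (fst (\<kappa> Q)) * inverse (snd (\<kappa> Q)))" if "Q \<in> M \<inter> N" for Q
    using infinity_affine_overlap(1,2)[OF C c, of Q] that
    by (simp_all add: N_def M_def \<psi>_def \<kappa>_def)
  have inj: "inj_on \<psi> N" "inj_on \<kappa> M"
    unfolding \<psi>_def N_def \<kappa>_def M_def
    by (rule inj_infinity_chart[OF C c(1)] inj_affine_chart[OF C c(2)])+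
  have inv: "holo2_on (\<lambda>z. inverse (f z)) W" if "holo2_on f W" "\<And>z. z \<in> W \<Longrightarrow> f z \<noteq> 0"
    for f :: "complex \<times> complex \<Rightarrow> complex" and W
    by (rule holo2_on_compose_holomorphic[of inverse "- {0}"])
      (use that in \<open>auto intro!: holomorphic_intros\<close>)
  have nz: "deriv (in_coord c (snd c')) x \<noteq> 0" if "x \<in> snd c ` (fst c \<inter> fst c')" for x
    using that coord_deriv_inverse[OF C c] by (force simp: coord_deriv_def)
  have h: "holo2_on (\<lambda>z. in_coord c (snd c') (fst z)) (\<psi> ` (M \<inter> N))"
    "holo2_on (\<lambda>z. inverse (deriv (in_coord c (snd c')) (fst z) * snd z)) (\<psi> ` (M \<inter> N))"
    unfolding img(1)
    by (intro inv holo2_on_transition_fst[OF c] holo2_intros; use nz in auto)+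
  show "holo2_on (\<lambda>z. fst (\<kappa> (inv_into N \<psi> z))) (\<psi> ` (M \<inter> N))"
    "holo2_on (\<lambda>z. snd (\<kappa> (inv_into N \<psi> z))) (\<psi> ` (M \<inter> N))"
    by (rule holo2_transition[OF inj(1) Int_lower2 o(1) h eq(1)]; simp)+
  have h': "holo2_on (\<lambda>z. in_coord c' (snd c) (fst z)) (\<kappa> ` (M \<inter> N))"
    "holo2_on (\<lambda>z. deriv (in_coord c' (snd c)) (fst z) * inverse (snd z)) (\<kappa> ` (M \<inter> N))"
    unfolding img(2)
    by (intro inv holo2_on_transition_fst[OF c(2,1)] holo2_intros; auto)+
  show "holo2_on (\<lambda>z. fst (\<psi> (inv_into M \<kappa> z))) (\<kappa> ` (M \<inter> N))"
    "holo2_on (\<lambda>z. snd (\<psi> (inv_into M \<kappa> z))) (\<kappa> ` (M \<inter> N))"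
    by (rule holo2_transition[OF inj(2) Int_lower1 o(2) h' eq(2)]; simp)+
qed

text \<open>This reduces questions about the compactified cotangent bundle near infinity, which refer to the affine
charts and the charts at infinity over all coordinates of the curve, to functions of \<open>(x, w)\<close>.\<close>

lemma infinity_chart_local_coords2:
  assumes c: "c \<in> local_coords C"
  shows "local_coords2 (Tbar C) (fst (infinity_chart C c)) (snd (infinity_chart C c))"
proof -
  let ?N = "fst (infinity_chart C c)" and ?\<psi> = "snd (infinity_chart C c)"
  have *: "open (?\<psi> ` (M \<inter> ?N)) \<and> open (\<kappa> ` (M \<inter> ?N)) \<and>
      holo2_on (\<lambda>z. fst (\<kappa> (inv_into ?N ?\<psi> z))) (?\<psi> ` (M \<inter> ?N)) \<and>
      holo2_on (\<lambda>z. snd (\<kappa> (inv_into ?N ?\<psi> z))) (?\<psi> ` (M \<inter> ?N)) \<and>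
      holo2_on (\<lambda>z. fst (?\<psi> (inv_into M \<kappa> z))) (\<kappa> ` (M \<inter> ?N)) \<and>
      holo2_on (\<lambda>z. snd (?\<psi> (inv_into M \<kappa> z))) (\<kappa> ` (M \<inter> ?N))"
    if M: "(M, \<kappa>) \<in> Tbar C" for M \<kappa>
  proof -
    obtain c' where c': "c' \<in> local_coords C"
      "(M, \<kappa>) = infinity_chart C c' \<or> (M, \<kappa>) = affine_chart C c'"
      using M unfolding Tbar_def by blast
    from c'(2) show ?thesis
    proof
      assume "(M, \<kappa>) = infinity_chart C c'"
      then have "M = fst (infinity_chart C c')" "\<kappa> = snd (infinity_chart C c')"
        by (metis fst_conv, metis snd_conv)
      then show ?thesis
        using infinity_infinity_transition[OF c c'(1)] infinity_infinity_transition[OF c'(1) c]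
        by (simp add: Int_commute)
    next
      assume "(M, \<kappa>) = affine_chart C c'"
      then have "M = fst (affine_chart C c')" "\<kappa> = snd (affine_chart C c')"
        by (metis fst_conv, metis snd_conv)
      then show ?thesis using infinity_affine_transition[OF c c'(1)] by simp
    qed
  qed
  have mem: "infinity_chart C c \<in> Tbar C" using c by (simp add: Tbar_def)
  then have "open (?\<psi> ` (?N \<inter> ?N))" using *[of ?N ?\<psi>] by simp
  moreover have "?N \<subseteq> points (Tbar C)" using mem by (auto simp: points_def)
  ultimately show ?thesis
    unfolding local_coords2_def open_in_def holo_on_def
    using * inj_infinity_chart[OF C c] by (auto simp: split_beta)
qed

end

section \<open>Orders of poles\<close>

lemma pole_order_cong:
  assumes "\<forall>\<^sub>F x in at z. f x = g x"
  shows "pole_order f z = pole_order g z"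
proof -
  have "(\<forall>\<^sub>F x in at z. f x = 0) \<longleftrightarrow> (\<forall>\<^sub>F x in at z. g x = 0)"
    by (rule eventually_cong[OF assms]) auto
  then show ?thesis using zorder_cong[OF assms refl] by (simp add: pole_order_def)
qed

lemma pole_order_cases:
  assumes "f meromorphic_on {z}"
  obtains (zero) "\<forall>\<^sub>F x in at z. f x = 0" "pole_order f z = -\<infinity>"
    | (nonzero) n g r where "pole_order f z = ereal (- real_of_int n)" "0 < r"
      "g holomorphic_on ball z r" "\<And>x. x \<in> ball z r \<Longrightarrow> g x \<noteq> 0"
      "\<And>x. x \<in> ball z r \<Longrightarrow> x \<noteq> z \<Longrightarrow> f x = g x * (x - z) powi n"
proof (cases "\<forall>\<^sub>F x in at z. f x = 0")
  case True
  then show ?thesis using zero by (simp add: pole_order_def)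
next
  case False
  then have "\<exists>\<^sub>F x in at z. f x \<noteq> 0" by (simp add: frequently_def)
  then obtain r where r: "zor_poly f z z \<noteq> 0" "0 < r" "zor_poly f z holomorphic_on cball z r"
    "\<forall>w\<in>cball z r - {z}. f w = zor_poly f z w * (w - z) powi zorder f z \<and> zor_poly f z w \<noteq> 0"
    using zorder_exist[of f z] assms by (auto simp: meromorphic_at_iff)
  show ?thesis
  proof (rule nonzero)
    show "pole_order f z = ereal (- real_of_int (zorder f z))" using False by (simp add: pole_order_def)
    show "zor_poly f z holomorphic_on ball z r" using r(3) ball_subset_cball holomorphic_on_subset by blast
    show "zor_poly f z x \<noteq> 0" if "x \<in> ball z r" for x
      using that r(1,4) by (cases "x = z") auto
    show "f x = zor_poly f z x * (x - z) powi zorder f z" if "x \<in> ball z r" "x \<noteq> z" for x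
      using that r(4) by auto
  qed (use r in auto)
qed

text \<open>A coordinate change composes the coefficient of a differential with a map of nonvanishing derivative and
multiplies it by a nonvanishing factor; neither affects the order.\<close>

lemma pole_order_transform:
  assumes f': "f' meromorphic_on {\<phi> z}" and \<phi>: "\<phi> analytic_on {z}" "deriv \<phi> z \<noteq> 0"
    and u: "u analytic_on {z}" "u z \<noteq> 0"
    and eq: "\<forall>\<^sub>F x in at z. f x = u x * f' (\<phi> x)"
  shows "pole_order f z = pole_order f' (\<phi> z)"
proof -
  have D: "(\<phi> has_field_derivative deriv \<phi> z) (at z)"
    using \<phi>(1) analytic_on_imp_differentiable_at field_differentiable_derivI by blast
  then have "\<forall>\<^sub>F x in at z. (\<phi> x - \<phi> z) / (x - z) \<noteq> 0"
    using \<phi>(2) unfolding has_field_derivative_iff by (rule tendsto_imp_eventually_ne)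
  then have ne: "\<forall>\<^sub>F x in at z. \<phi> x \<noteq> \<phi> z" by eventually_elim auto
  have "(\<phi> \<longlongrightarrow> \<phi> z) (at z)" using D DERIV_isCont isCont_def by blast
  then have lim: "filterlim \<phi> (at (\<phi> z)) (at z)" using ne by (simp add: filterlim_at)
  show ?thesis
  proof (cases "\<forall>\<^sub>F w in at (\<phi> z). f' w = 0")
    case True
    then have "\<forall>\<^sub>F x in at z. f' (\<phi> x) = 0" using lim by (rule eventually_compose_filterlim)
    with eq have "\<forall>\<^sub>F x in at z. f x = 0" by eventually_elim auto
    with True show ?thesis by (simp add: pole_order_def)
  next
    case False
    then have "\<exists>\<^sub>F w in at (\<phi> z). f' w \<noteq> 0" by (simp add: frequently_def)
    then have nz: "\<forall>\<^sub>F w in at (\<phi> z). f' w \<noteq> 0"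
      using f' non_zero_neighbour by (auto simp: meromorphic_at_iff)
    then have nz': "\<forall>\<^sub>F x in at z. f' (\<phi> x) \<noteq> 0" using lim by (rule eventually_compose_filterlim)
    have "isCont u z" using u(1) analytic_at_imp_isCont by blast
    then have "\<forall>\<^sub>F x in at z. u x \<noteq> 0"
      using u(2) tendsto_imp_eventually_ne isCont_def by blast
    then have nzu: "\<exists>\<^sub>F x in at z. u x \<noteq> 0" by (simp add: eventually_frequently)
    have "\<forall>\<^sub>F x in at z. f x \<noteq> 0"
      using eq nz' \<open>\<forall>\<^sub>F x in at z. u x \<noteq> 0\<close> by eventually_elim auto
    then have nzf: "\<not> (\<forall>\<^sub>F x in at z. f x = 0)"
      using eventually_frequently[of "at z" "\<lambda>x. f x \<noteq> 0"] by (simp add: frequently_def)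
    have z1: "zorder (\<lambda>x. \<phi> x - \<phi> z) z = 1"
    proof (rule zorder_zero_eqI')
      show "(\<lambda>x. \<phi> x - \<phi> z) analytic_on {z}" by (intro analytic_intros \<phi>)
      have "deriv (\<lambda>x. \<phi> x - \<phi> z) z = deriv \<phi> z"
        by (rule DERIV_imp_deriv) (use D in \<open>auto intro!: derivative_eq_intros\<close>)
      then show "(deriv ^^ nat 1) (\<lambda>x. \<phi> x - \<phi> z) z \<noteq> 0" using \<phi>(2) by simp
    qed auto
    have "zorder f z = zorder (\<lambda>x. u x * f' (\<phi> x)) z" by (rule zorder_cong[OF eq refl])
    also have "\<dots> = zorder u z + zorder (\<lambda>x. f' (\<phi> x)) z"
      by (rule zorder_mult) (use u f' \<phi> nzu nz' in \<open>auto intro: analytic_on_imp_meromorphic_on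
        meromorphic_on_compose eventually_frequently\<close>)
    also have "zorder u z = 0" by (rule zorder_eq_0I[OF u])
    also have "zorder (\<lambda>x. f' (\<phi> x)) z = zorder f' (\<phi> z) * zorder (\<lambda>x. \<phi> x - \<phi> z) z"
      using zorder_compose'[of f' \<phi> z] f' \<phi>(1) nz ne by (simp add: meromorphic_at_iff o_def)
    finally show ?thesis using False nzf z1 by (simp add: pole_order_def)
  qed
qed

lemma pole_order_cmult:
  assumes "f meromorphic_on {z}" "k \<noteq> 0"
  shows "pole_order (\<lambda>x. k * f x) z = pole_order f z"
  using pole_order_transform[of f "\<lambda>x. x" z "\<lambda>_. k"] assms by auto

lemma integral_or_minus_infinity_pole_order:
  assumes "f meromorphic_on {z}"
  shows "pole_order f z = -\<infinity> \<or> (\<exists>n::int. pole_order f z = ereal n)"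
  by (simp add: pole_order_def) (metis of_int_minus)

text \<open>If \<open>f\<close> vanishes near the point, its pole order is \<open>-\<infinity>\<close> and \<open>\<beta> = 0\<close> serves.\<close>

lemma pole_order_bound:
  assumes f: "f meromorphic_on {0}" and bound: "pole_order f 0 = -\<infinity> \<or> (\<exists>n::int. pole_order f 0 = ereal n \<and> n \<le> int m)"
  obtains r \<beta> where "0 < r" "\<beta> holomorphic_on ball 0 r"
    "\<And>x. x \<in> ball 0 r \<Longrightarrow> x \<noteq> 0 \<Longrightarrow> f x = \<beta> x / x ^ m"
  using f
proof (cases rule: pole_order_cases)
  case zero
  then obtain d where "0 < d" "\<And>x. x \<noteq> 0 \<Longrightarrow> dist x 0 < d \<Longrightarrow> f x = 0"
    unfolding eventually_at by blast
  then show thesis by (intro that[of d "\<lambda>_. 0"]) auto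
next
  case (nonzero n g r)
  have n: "0 \<le> int m + n" using bound nonzero(1) by auto
  show thesis
  proof (rule that[OF nonzero(2)])
    show "(\<lambda>x. g x * x ^ nat (int m + n)) holomorphic_on ball 0 r"
      by (intro holomorphic_intros nonzero(3))
    fix x :: complex assume x: "x \<in> ball 0 r" "x \<noteq> 0"
    have "x ^ nat (int m + n) = x ^ m * x powi n"
      using x(2) n by (simp add: power_int_add flip: power_int_of_nat)
    then show "f x = g x * x ^ nat (int m + n) / x ^ m"
      using nonzero(5)[OF x] x(2) by simp
  qed
qed

section \<open>Trace and determinant of a meromorphic Higgs field\<close>

text \<open>On the overlap of two trivialisations the Higgs field is conjugated by the transition matrix.\<close>

lemma conjugate_trace_det:
  fixes A B T :: "complex^2^2"
  assumes "A ** T = T ** B" "det T \<noteq> 0"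
  shows "trace A = trace B" "det A = det B"
proof -
  obtain T' where T': "T ** T' = mat 1" "T' ** T = mat 1"
    using assms(2) invertible_det_nz unfolding invertible_def by blast
  have "A = T ** (B ** T')"
    using assms(1) T' by (metis matrix_mul_assoc matrix_mul_rid)
  then have "trace A = trace ((B ** T') ** T)" using trace_mul_sym by metis
  also have "(B ** T') ** T = B" using T' by (metis matrix_mul_assoc matrix_mul_rid)
  finally show "trace A = trace B" .
  have "det A * det T = det T * det B" using assms(1) by (metis det_mul)
  then show "det A = det B" using assms(2) by simp
qed

context
  fixes C :: "'a curve" and H :: "('a, 'i) higgs"
  assumes C: "riemann_surface C" and H: "meromorphic_higgs_bundle C H"
begin

lemma frame_at:
  assumes "p \<in> topspace (ctop C)"
  shows "frame_at H p \<in> idx H" "p \<in> triv H (frame_at H p)"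
proof -
  have "(\<Union>i\<in>idx H. triv H i) = topspace (ctop C)"
    using H unfolding meromorphic_higgs_bundle_def rank2_bundle_def by (elim conjE)
  then have "\<exists>i. i \<in> idx H \<and> p \<in> triv H i" using assms by blast
  from someI_ex[OF this] show "frame_at H p \<in> idx H" "p \<in> triv H (frame_at H p)"
    by (auto simp: frame_at_def)
qed

text \<open>The definition of \<open>a1\<close> and \<open>a2\<close> chooses a trivialisation at each point separately.  Invariance under
conjugation allows one trivialisation to be used on a whole neighbourhood.\<close>

lemma a_any_frame:
  assumes i: "i \<in> idx H" "p \<in> triv H i" and c: "c \<in> local_coords C" "p \<in> fst c"
    and np: "poles H p = 0"
  shows "a1 H c p = - trace (hfield H i c p)" "a2 H c p = det (hfield H i c p)"
proof -
  have "p \<in> topspace (ctop C)" using local_coords_openin[OF c(1)] c(2) openin_subset by blast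
  note j = frame_at[OF this]
  let ?j = "frame_at H p"
  have "hfield H ?j c p ** transition H ?j i p = transition H ?j i p ** hfield H i c p"
    using H i j c np unfolding meromorphic_higgs_bundle_def by blast
  moreover have "\<forall>i\<in>idx H. \<forall>j\<in>idx H. (\<forall>a b. holo_on_curve C (\<lambda>p. transition H i j p $ a $ b)
      (triv H i \<inter> triv H j)) \<and> (\<forall>p\<in>triv H i \<inter> triv H j. det (transition H i j p) \<noteq> 0)"
    using H unfolding meromorphic_higgs_bundle_def rank2_bundle_def by (elim conjE)
  then have "det (transition H ?j i p) \<noteq> 0" using i j by blast
  ultimately show "a1 H c p = - trace (hfield H i c p)" "a2 H c p = det (hfield H i c p)"
    using conjugate_trace_det unfolding a1_def a2_def by metis+
qed

lemma a_change_coords: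
  assumes c: "c \<in> local_coords C" "c' \<in> local_coords C" and p: "p \<in> fst c" "p \<in> fst c'"
    and np: "poles H p = 0"
  shows "a1 H c p = coord_deriv c' c p * a1 H c' p" "a2 H c p = coord_deriv c' c p ^ 2 * a2 H c' p"
proof -
  have "p \<in> topspace (ctop C)" using local_coords_openin[OF c(1)] p(1) openin_subset by blast
  note j = frame_at[OF this]
  have "hfield H (frame_at H p) c p $ a $ b = coord_deriv c' c p * hfield H (frame_at H p) c' p $ a $ b"
    for a b using H j c p np unfolding meromorphic_higgs_bundle_def by blast
  then show "a1 H c p = coord_deriv c' c p * a1 H c' p" "a2 H c p = coord_deriv c' c p ^ 2 * a2 H c' p"
    by (simp_all add: a1_def a2_def trace_def det_2 sum_2 power2_eq_square algebra_simps)
qed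

text \<open>The poles are finitely many, so a punctured neighbourhood of any point avoids them.\<close>

lemma eventually_in_chart:
  assumes c: "c \<in> local_coords C" and p: "p \<in> fst c" and V: "openin (ctop C) V" "p \<in> V"
  shows "\<forall>\<^sub>F x in at (snd c p). \<exists>q. q \<in> fst c \<and> q \<in> V \<and> x = snd c q \<and> poles H q = 0"
proof -
  let ?F = "snd c ` ({q. poles H q \<noteq> 0} \<inter> fst c) - {snd c p}"
  have "finite {q. poles H q \<noteq> 0}" using H unfolding meromorphic_higgs_bundle_def by blast
  then have "closed ?F" by (intro finite_imp_closed) auto
  then have "open (snd c ` (fst c \<inter> V) - ?F)"
    using local_coords_open_image[OF c V(1)] open_Diff by blast
  moreover have "snd c p \<in> snd c ` (fst c \<inter> V) - ?F" using p V by blast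
  ultimately have "\<forall>\<^sub>F x in at (snd c p). x \<in> snd c ` (fst c \<inter> V) - ?F - {snd c p}"
    using eventually_at_in_open by blast
  then show ?thesis by eventually_elim blast
qed

lemma meromorphic_a:
  assumes c: "c \<in> local_coords C" and p: "p \<in> fst c"
  shows "in_coord c (a1 H c) meromorphic_on {snd c p}" "in_coord c (a2 H c) meromorphic_on {snd c p}"
proof -
  have "p \<in> topspace (ctop C)" using local_coords_openin[OF c] p openin_subset by blast
  note j = frame_at[OF this]
  let ?i = "frame_at H p" and ?z = "snd c p"
  define f where "f a b x = in_coord c (hfield H ?i c) x $ a $ b" for a b :: 2 and x
  have f: "f a b meromorphic_on {?z}" for a b
  proof -
    obtain h where h: "h analytic_on {?z}" "\<forall>\<^sub>F x in at ?z. (x - ?z) ^ poles H p * f a b x = h x"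
      using H j c p unfolding meromorphic_higgs_bundle_def f_def by blast
    have "\<forall>\<^sub>F x in at ?z. x \<noteq> ?z" by (simp add: eventually_at_filter)
    with h(2) have "\<forall>\<^sub>F x in at ?z. f a b x = h x / (x - ?z) ^ poles H p"
      by eventually_elim (auto simp: field_simps)
    then have "f a b meromorphic_on {?z} \<longleftrightarrow> (\<lambda>x. h x / (x - ?z) ^ poles H p) meromorphic_on {?z}"
      by (intro meromorphic_on_cong) auto
    moreover have "(\<lambda>x. h x / (x - ?z) ^ poles H p) meromorphic_on {?z}"
      by (intro meromorphic_on_divide analytic_on_imp_meromorphic_on h(1) analytic_intros)
    ultimately show ?thesis by blast
  qed
  have "\<forall>i\<in>idx H. openin (ctop C) (triv H i)"
    using H unfolding meromorphic_higgs_bundle_def rank2_bundle_def by (elim conjE)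
  then have "openin (ctop C) (triv H ?i)" using j by blast
  from eventually_in_chart[OF c p this j(2)]
  have ev: "\<forall>\<^sub>F x in at ?z. in_coord c (a1 H c) x = - (f 1 1 x + f 2 2 x)"
    "\<forall>\<^sub>F x in at ?z. in_coord c (a2 H c) x = f 1 1 x * f 2 2 x - f 1 2 x * f 2 1 x"
    by (eventually_elim, use a_any_frame[OF j(1) _ c] in
        \<open>force simp: in_coord_apply[OF c] f_def trace_def sum_2 det_2\<close>)+
  have "in_coord c (a1 H c) meromorphic_on {?z} \<longleftrightarrow> (\<lambda>x. - (f 1 1 x + f 2 2 x)) meromorphic_on {?z}"
    by (intro meromorphic_on_cong) (use ev in auto)
  then show "in_coord c (a1 H c) meromorphic_on {?z}" by (auto intro!: meromorphic_intros f)
  have "in_coord c (a2 H c) meromorphic_on {?z} \<longleftrightarrow>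
      (\<lambda>x. f 1 1 x * f 2 2 x - f 1 2 x * f 2 1 x) meromorphic_on {?z}"
    by (intro meromorphic_on_cong) (use ev in auto)
  then show "in_coord c (a2 H c) meromorphic_on {?z}" by (auto intro!: meromorphic_intros f)
qed

text \<open>The pole orders that determine the blow-ups are computed in an arbitrarily chosen coordinate, those of
the quantum curve in the given one.\<close>

lemma form_pole_order_a:
  assumes c: "c \<in> coords_at C p"
  shows "form_pole_order C (a1 H) p = pole_order (in_coord c (a1 H c)) (snd c p)"
    "form_pole_order C (a2 H) p = pole_order (in_coord c (a2 H c)) (snd c p)"
proof -
  define d where "d = (SOME c. c \<in> coords_at C p)"
  have "d \<in> coords_at C p" unfolding d_def using c by (rule someI)
  then have d: "d \<in> local_coords C" "p \<in> fst d" by (auto simp: coords_at_def)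
  have c': "c \<in> local_coords C" "p \<in> fst c" using c by (auto simp: coords_at_def)
  let ?z = "snd d p" and ?\<phi> = "in_coord d (snd c)"
  let ?A = "snd d ` (fst d \<inter> fst c)"
  have hol: "?\<phi> holomorphic_on ?A" "open ?A" "?z \<in> ?A"
    using holomorphic_transition[OF C d(1) c'(1)] open_overlap[OF C d(1) c'(1)] d c' by auto
  have \<phi>: "?\<phi> analytic_on {?z}" "deriv ?\<phi> analytic_on {?z}"
    using hol holomorphic_deriv[OF hol(1,2)] analytic_at by blast+
  have \<phi>z: "?\<phi> ?z = snd c p" by (rule in_coord_apply[OF d])
  have "coord_deriv d c p * coord_deriv c d p = 1" "coord_deriv c d p = deriv ?\<phi> ?z"
    using coord_deriv_inverse[OF C d(1) c'(1)] d(2) c'(2) coord_deriv_inverse[OF C c'(1) d(1)]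
    by (auto simp: coord_deriv_def mult.commute)
  then have nz: "deriv ?\<phi> ?z \<noteq> 0" by auto
  have ev: "\<forall>\<^sub>F x in at ?z. in_coord d (a1 H d) x = deriv ?\<phi> x * in_coord c (a1 H c) (?\<phi> x)"
    "\<forall>\<^sub>F x in at ?z. in_coord d (a2 H d) x = deriv ?\<phi> x ^ 2 * in_coord c (a2 H c) (?\<phi> x)"
    using eventually_in_chart[OF d local_coords_openin[OF c'(1)] c'(2)]
    by (eventually_elim, use a_change_coords[OF d(1) c'(1)] in
        \<open>force simp: in_coord_apply[OF d(1)] in_coord_apply[OF c'(1)] coord_deriv_def\<close>)+
  note m = meromorphic_a[OF c', folded \<phi>z]
  have "pole_order (in_coord d (a1 H d)) ?z = pole_order (in_coord c (a1 H c)) (?\<phi> ?z)"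
    by (rule pole_order_transform[OF m(1) \<phi>(1) nz \<phi>(2) nz ev(1)])
  then show "form_pole_order C (a1 H) p = pole_order (in_coord c (a1 H c)) (snd c p)"
    by (simp add: form_pole_order_def d_def[symmetric] \<phi>z)
  have "(\<lambda>x. deriv ?\<phi> x ^ 2) analytic_on {?z}" "deriv ?\<phi> ?z ^ 2 \<noteq> 0"
    using nz by (auto intro!: analytic_intros \<phi>)
  then have "pole_order (in_coord d (a2 H d)) ?z = pole_order (in_coord c (a2 H c)) (?\<phi> ?z)"
    by (rule pole_order_transform[OF m(2) \<phi>(1) nz _ _ ev(2)])
  then show "form_pole_order C (a2 H) p = pole_order (in_coord c (a2 H c)) (snd c p)"
    by (simp add: form_pole_order_def d_def[symmetric] \<phi>z)
qed

end

section \<open>From the invariant \<open>r\<close> to the number of blow-ups\<close>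

lemma invariant_r_simps:
  "invariant_r (-\<infinity>) (-\<infinity>) = -\<infinity>"
  "invariant_r (ereal x) (-\<infinity>) = ereal x"
  "invariant_r (-\<infinity>) (ereal y) = ereal (y / 2)"
  "invariant_r (ereal x) (ereal y) = ereal (if 2 * x \<ge> y then x else y / 2)"
  by (auto simp: invariant_r_def numeral_eq_ereal)

text \<open>An integral \<open>r\<close> equals \<open>\<rho>\<close>; if \<open>r = l/2\<close> with odd \<open>l\<close>, rounding up adds \<open>1/2\<close>.\<close>

lemma invariant_r_ceiling:
  fixes k l :: ereal and \<rho> :: nat
  assumes k: "k = -\<infinity> \<or> (\<exists>n::int. k = ereal n)" and l: "l = -\<infinity> \<or> (\<exists>n::int. l = ereal n)"
    and \<rho>: "int \<rho> = \<lceil>real_of_ereal (invariant_r k l)\<rceil>"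
  shows "\<rho> = 1 \<Longrightarrow> (0 < k \<or> 0 < l) \<and> k \<le> 1 \<and> l \<le> 2"
    and "\<rho> > 1 \<Longrightarrow> \<not> (k \<le> 1 \<and> l \<le> 2) \<and> 1 < invariant_r k l \<and>
      (ereal (real \<rho> - 1) = invariant_r k l - 1 \<or> ereal (real \<rho> - 3/2) = invariant_r k l - 1)"
proof -
  have half: "n = 2 * int \<rho> \<or> n = 2 * int \<rho> - 1" if "int \<rho> = \<lceil>real_of_int n / 2\<rceil>" for n
    using that by linarith
  show "(0 < k \<or> 0 < l) \<and> k \<le> 1 \<and> l \<le> 2" if "\<rho> = 1"
    using k l
  proof (elim disjE exE)
    assume "k = -\<infinity>" "l = -\<infinity>"
    then show ?thesis using \<rho> that by (simp add: invariant_r_simps)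
  next
    fix n :: int assume kl: "k = -\<infinity>" "l = ereal n"
    then have "n = 1 \<or> n = 2" using \<rho> that half[of n] by (auto simp: invariant_r_simps)
    then show ?thesis using kl by (auto simp: numeral_eq_ereal)
  next
    fix n :: int assume kl: "k = ereal n" "l = -\<infinity>"
    then have "n = 1" using \<rho> that by (simp add: invariant_r_simps)
    then show ?thesis using kl by simp
  next
    fix n n' :: int assume kl: "k = ereal n" "l = ereal n'"
    show ?thesis
    proof (cases "real_of_int n' \<le> 2 * real_of_int n")
      case True
      then have "n = 1" using \<rho> that kl by (simp add: invariant_r_simps)
      then show ?thesis using kl True by (simp add: numeral_eq_ereal)
    next
      case False
      then have "n' = 1 \<or> n' = 2" using \<rho> that half[of n'] kl by (auto simp: invariant_r_simps)
      moreover from this False have "n \<le> 1" by linarith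
      ultimately show ?thesis using kl by (auto simp: numeral_eq_ereal one_ereal_def)
    qed
  qed
  show "\<not> (k \<le> 1 \<and> l \<le> 2) \<and> 1 < invariant_r k l \<and>
      (ereal (real \<rho> - 1) = invariant_r k l - 1 \<or> ereal (real \<rho> - 3/2) = invariant_r k l - 1)"
    if "\<rho> > 1"
    using k l
  proof (elim disjE exE)
    assume "k = -\<infinity>" "l = -\<infinity>"
    then show ?thesis using \<rho> that by (simp add: invariant_r_simps)
  next
    fix n :: int assume "k = -\<infinity>" "l = ereal n"
    then show ?thesis using \<rho> that half[of n]
      by (auto simp: invariant_r_simps numeral_eq_ereal one_ereal_def field_simps)
  next
    fix n :: int assume "k = ereal n" "l = -\<infinity>"
    then show ?thesis using \<rho> that
      by (auto simp: invariant_r_simps numeral_eq_ereal one_ereal_def)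
  next
    fix n n' :: int assume "k = ereal n" "l = ereal n'"
    then show ?thesis using \<rho> that half[of n']
      by (auto simp: invariant_r_simps numeral_eq_ereal one_ereal_def field_simps split: if_splits)
  qed
qed

text \<open>Class \<open>\<rho> - 3/2\<close> means \<open>r = \<rho> - 1/2\<close>.  This is not an integer, so it is not \<open>k\<close>, and \<open>l\<close> is odd.\<close>

lemma invariant_r_half_integral:
  fixes k l :: ereal and \<rho> :: nat
  assumes k: "k = -\<infinity> \<or> (\<exists>n::int. k = ereal n)" and l: "l = -\<infinity> \<or> (\<exists>n::int. l = ereal n)"
    and \<rho>: "\<rho> > 1" "ereal (real \<rho> - 3/2) = invariant_r k l - 1"
  obtains m :: nat where "1 \<le> m" "l = ereal (2 * real m + 1)" "k = -\<infinity> \<or> (\<exists>n::int. k = ereal n \<and> n \<le> int m)"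
proof (rule that[of "\<rho> - 1"])
  show "1 \<le> \<rho> - 1" using \<rho>(1) by simp
  have half: "2 * (real \<rho> - 3/2) \<noteq> 2 * (real_of_int n - 1)" for n
  proof
    assume "2 * (real \<rho> - 3/2) = 2 * (real_of_int n - 1)"
    then have "real_of_int (2 * int \<rho> - 1) = real_of_int (2 * n)" by simp
    then have "2 * int \<rho> - 1 = 2 * n" by (simp only: of_int_eq_iff)
    then show False by presburger
  qed
  have "l = ereal (2 * real (\<rho> - 1) + 1) \<and> (k = -\<infinity> \<or> (\<exists>n::int. k = ereal n \<and> n \<le> int (\<rho> - 1)))"
    using k l
  proof (elim disjE exE)
    assume "k = -\<infinity>" "l = -\<infinity>"
    then show ?thesis using \<rho>(2) by (simp add: invariant_r_simps one_ereal_def)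
  next
    fix n :: int assume "k = -\<infinity>" "l = ereal n"
    then show ?thesis using \<rho> by (simp add: invariant_r_simps one_ereal_def of_nat_diff)
  next
    fix n :: int assume "k = ereal n" "l = -\<infinity>"
    then show ?thesis using \<rho>(2) half[of n] by (simp add: invariant_r_simps one_ereal_def)
  next
    fix n n' :: int assume kl: "k = ereal n" "l = ereal n'"
    show ?thesis
    proof (cases "real_of_int n' \<le> 2 * real_of_int n")
      case True
      then show ?thesis using \<rho>(2) kl half[of n] by (simp add: invariant_r_simps one_ereal_def)
    next
      case False
      then have "real_of_int n' = 2 * real \<rho> - 1"
        using \<rho>(2) kl by (simp add: invariant_r_simps one_ereal_def)
      moreover have "n \<le> int (\<rho> - 1)" using False calculation \<rho>(1) by (simp add: of_nat_diff)
      ultimately show ?thesis using kl \<rho>(1) by (simp add: of_nat_diff)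
    qed
  qed
  then show "l = ereal (2 * real (\<rho> - 1) + 1)" "k = -\<infinity> \<or> (\<exists>n::int. k = ereal n \<and> n \<le> int (\<rho> - 1))"
    by auto
qed

section \<open>The normal form of the quantum curve\<close>

lemma normal_form_quantum_curve:
  assumes "hbar \<noteq> 0" and "in_coord c (a1 H c) meromorphic_on {0}" "in_coord c (a2 H c) meromorphic_on {0}"
  shows "normal_form (quantum_curve_op H hbar c)
    (\<lambda>x. inverse hbar * in_coord c (a1 H c) x) (\<lambda>x. inverse hbar ^ 2 * in_coord c (a2 H c) x)"
  unfolding normal_form_def
proof (intro conjI exI[of _ "1::real"] exI[of _ "\<lambda>_. hbar ^ 2"] ballI allI impI)
  fix x :: complex and \<Psi> assume "\<Psi> analytic_on {x}"
  then have "deriv \<Psi> analytic_on {x}" by (rule analytic_deriv)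
  then have "deriv \<Psi> field_differentiable at x" by (simp add: analytic_on_imp_differentiable_at)
  then have "deriv (\<lambda>t. hbar * deriv \<Psi> t) x = hbar * deriv (deriv \<Psi>) x" by (rule deriv_cmult)
  moreover have "hbar * inverse hbar = 1" using assms(1) by simp
  ultimately show "quantum_curve_op H hbar c \<Psi> x = hbar\<^sup>2 * (deriv (deriv \<Psi>) x +
      inverse hbar * in_coord c (a1 H c) x * deriv \<Psi> x + inverse hbar ^ 2 * in_coord c (a2 H c) x * \<Psi> x)"
    unfolding quantum_curve_op_def by algebra
qed (use assms in \<open>auto intro!: meromorphic_intros\<close>)

text \<open>An operator \<open>e (\<Psi>'' + b1 \<Psi>' + b2 \<Psi>)\<close> is determined by its values on \<open>1\<close>, \<open>x\<close> and \<open>x\<^sup>2\<close>.\<close>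

lemma normal_form_quantum_curve_unique:
  assumes "hbar \<noteq> 0" and nf: "normal_form (quantum_curve_op H hbar c) b1 b2"
  shows "\<forall>\<^sub>F x in at 0. b1 x = inverse hbar * in_coord c (a1 H c) x"
    "\<forall>\<^sub>F x in at 0. b2 x = inverse hbar ^ 2 * in_coord c (a2 H c) x"
proof -
  obtain r e where r: "0 < r" and re: "\<And>x \<Psi>. x \<in> ball 0 r - {0} \<Longrightarrow> \<Psi> analytic_on {x} \<Longrightarrow>
      quantum_curve_op H hbar c \<Psi> x = e x * (deriv (deriv \<Psi>) x + b1 x * deriv \<Psi> x + b2 x * \<Psi> x)"
    using nf unfolding normal_form_def by blast
  have ev: "\<forall>\<^sub>F x in at 0. x \<in> ball 0 r - {0::complex}" using r by (intro eventually_at_in_open) auto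
  have d1: "deriv (\<lambda>_::complex. 1::complex) = (\<lambda>_. 0)" "deriv (\<lambda>_::complex. 0::complex) = (\<lambda>_. 0)"
    "deriv (\<lambda>x::complex. x) = (\<lambda>_. 1)" by (auto intro!: ext)
  have d2: "deriv (\<lambda>x::complex. x ^ 2) = (\<lambda>x. 2 * x)" "deriv (\<lambda>x::complex. 2 * x) = (\<lambda>_. 2)"
    "deriv (\<lambda>x::complex. hbar * (2 * x)) = (\<lambda>_. hbar * 2)" "deriv (\<lambda>x::complex. hbar) = (\<lambda>_. 0)"
    by (auto intro!: ext DERIV_imp_deriv derivative_eq_intros)
  have *: "b1 x = inverse hbar * in_coord c (a1 H c) x \<and> b2 x = inverse hbar ^ 2 * in_coord c (a2 H c) x"
    if x: "x \<in> ball 0 r - {0}" for x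
  proof -
    let ?A = "in_coord c (a1 H c) x" and ?B = "in_coord c (a2 H c) x"
    have 1: "?B = e x * b2 x"
      using re[OF x, of "\<lambda>_. 1"] by (simp add: quantum_curve_op_def d1 analytic_on_const)
    have 2: "?A * hbar + ?B * x = e x * (b1 x + b2 x * x)"
      using re[OF x, of "\<lambda>x. x"] by (simp add: quantum_curve_op_def d1 d2 analytic_on_ident)
    have 3: "hbar * (hbar * 2) + ?A * (hbar * (2 * x)) + ?B * x ^ 2 = e x * (2 + b1 x * (2 * x) + b2 x * x ^ 2)"
      using re[OF x, of "\<lambda>x. x ^ 2"]
      by (simp add: quantum_curve_op_def d1 d2 analytic_on_power analytic_on_ident)
    from 1 2 have 4: "?A * hbar = e x * b1 x" by (simp add: algebra_simps)
    have "2 * hbar ^ 2 + (?A * hbar) * (2 * x) + ?B * x ^ 2 = e x * (2 + b1 x * (2 * x) + b2 x * x ^ 2)"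
      using 3 by (simp add: mult_ac power2_eq_square)
    then have "e x = hbar ^ 2" unfolding 1 4 by (simp add: algebra_simps)
    with 1 4 assms(1) show ?thesis by (simp add: field_simps power2_eq_square)
  qed
  show "\<forall>\<^sub>F x in at 0. b1 x = inverse hbar * in_coord c (a1 H c) x"
    "\<forall>\<^sub>F x in at 0. b2 x = inverse hbar ^ 2 * in_coord c (a2 H c) x"
    using ev by (eventually_elim, use * in blast)+
qed

section \<open>The spectral curve at infinity\<close>

text \<open>The local equation of the spectral curve is compared with \<open>x\<^sup>l + x\<^bsup>m+1\<^esup> \<beta> w + \<alpha> w\<^sup>2\<close>, \<open>l = 2m + 1\<close>, and then
brought into normal form by the coordinate change \<open>\<theta>\<close>.\<close>

lemma cusp_at_infinity:
  fixes C :: "'a curve" and H :: "('a, 'i) higgs"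
  assumes C: "riemann_surface C" and H: "meromorphic_higgs_bundle C H"
    and \<Sigma>: "spectral_curve C H \<Sigma>"
    and c: "c \<in> coords_at C p" "snd c p = 0"
    and m: "1 \<le> m" and l: "pole_order (in_coord c (a2 H c)) 0 = ereal (2 * real m + 1)"
    and k: "pole_order (in_coord c (a1 H c)) 0 = -\<infinity> \<or>
      (\<exists>n::int. pole_order (in_coord c (a1 H c)) 0 = ereal n \<and> n \<le> int m)"
  shows "cusp_singularity (Tbar C) \<Sigma> (AtInf p)"
proof -
  have c': "c \<in> local_coords C" "p \<in> fst c" using c(1) by (auto simp: coords_at_def)
  let ?S = "Tbar C" and ?K = "fst (infinity_chart C c)" and ?\<kappa> = "snd (infinity_chart C c)"
  let ?P = "AtInf p"
  let ?A1 = "in_coord c (a1 H c)" and ?A2 = "in_coord c (a2 H c)"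
  have inj: "\<And>M \<kappa>. (M, \<kappa>) \<in> ?S \<Longrightarrow> inj_on \<kappa> M" by (rule inj_Tbar_chart[OF C])
  have lc: "local_coords2 ?S ?K ?\<kappa>" by (rule infinity_chart_local_coords2[OF C c'(1)])
  have injK: "inj_on ?\<kappa> ?K" by (rule inj_infinity_chart[OF C c'(1)])
  have PK: "?P \<in> ?K" "?\<kappa> ?P = (0, 0)" using c' c(2) by (auto simp: infinity_chart_def)
  have pK: "open_in ?S ?K" using lc by (simp add: local_coords2_def)
  then have "?P \<in> points ?S" using PK(1) unfolding open_in_def by blast
  then obtain N h where N: "open_in ?S N" "?P \<in> N" "holo_on ?S (\<Sigma> ?P) N" "holo_on ?S h N"
      "coprime_at ?S ?P (\<Sigma> ?P) h"
    and \<Sigma>h: "\<And>R. R \<in> N \<Longrightarrow> R \<notin> C_infinity C \<Longrightarrow> proj R \<in> fst c \<Longrightarrow> poles H (proj R) = 0 \<Longrightarrow>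
      \<Sigma> ?P R = h R * char_section H c R"
    using \<Sigma> c(1) unfolding spectral_curve_def by (metis proj.simps(2))

  have N': "open_in ?S (N \<inter> ?K)" by (rule open_in_Int[OF inj N(1) pK])
  define W where "W = ?\<kappa> ` (N \<inter> ?K)"
  define f where "f z = \<Sigma> ?P (inv_into ?K ?\<kappa> z)" for z
  define h' where "h' z = h (inv_into ?K ?\<kappa> z)" for z
  have W: "open W" "(0, 0) \<in> W"
    using coords_image_open_in(1)[OF inj lc N'] N(2) PK by (force simp: W_def)+
  have fh: "holo2_on f W" "holo2_on h' W"
    using coords_image_open_in(2)[OF inj lc N' _ holo_on_subset[OF N(3)]]
      coords_image_open_in(2)[OF inj lc N' _ holo_on_subset[OF N(4)]]
    by (auto simp: W_def f_def[abs_def] h'_def[abs_def])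

  have mer: "?A1 meromorphic_on {0}" "?A2 meromorphic_on {0}"
    using meromorphic_a[OF C H c'] c(2) by simp_all
  obtain \<alpha> r2 where \<alpha>: "0 < r2" "\<alpha> holomorphic_on ball 0 r2" "\<And>x. x \<in> ball 0 r2 \<Longrightarrow> \<alpha> x \<noteq> 0"
    "\<And>x. x \<in> ball 0 r2 \<Longrightarrow> x \<noteq> 0 \<Longrightarrow> ?A2 x = \<alpha> x / x ^ (2 * m + 1)"
    using mer(2)
  proof (cases rule: pole_order_cases)
    case (nonzero n g r)
    have "real_of_int (- n) = real_of_int (int (2 * m + 1))" using l nonzero(1) by simp
    then have n: "n = - int (2 * m + 1)" by (simp only: of_int_eq_iff)
    have "?A2 x = g x / x ^ (2 * m + 1)" if "x \<in> ball 0 r" "x \<noteq> 0" for x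
      using nonzero(5)[OF that] unfolding n power_int_minus power_int_of_nat by (simp add: divide_inverse)
    then show thesis using that nonzero by blast
  qed (use l in auto)
  obtain \<beta> r1 where \<beta>: "0 < r1" "\<beta> holomorphic_on ball 0 r1"
    "\<And>x. x \<in> ball 0 r1 \<Longrightarrow> x \<noteq> 0 \<Longrightarrow> ?A1 x = \<beta> x / x ^ m"
    using pole_order_bound[OF mer(1) k] by metis
  obtain r3 where r3: "0 < r3" "ball 0 r3 \<times> ball 0 r3 \<subseteq> W"
    using open_square_in_open[OF W] by metis
  have "openin (ctop C) (fst c)" by (rule local_coords_openin[OF c'(1)])
  from eventually_in_chart[OF C H c' this c'(2)]
  obtain r4 where r4: "0 < r4"
    "\<And>x. x \<noteq> 0 \<Longrightarrow> dist x 0 < r4 \<Longrightarrow> \<exists>q. q \<in> fst c \<and> x = snd c q \<and> poles H q = 0"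
    unfolding eventually_at c(2) by blast
  define r where "r = Min {r1, r2, r3, r4}"
  have r: "0 < r" "r \<le> r1" "r \<le> r2" "r \<le> r3" "r \<le> r4"
    using \<alpha>(1) \<beta>(1) r3(1) r4(1) by (auto simp: r_def)
  let ?B = "ball (0::complex) r"
  have sub: "?B \<subseteq> ball 0 r1" "?B \<subseteq> ball 0 r2" "?B \<times> ?B \<subseteq> W"
    using r r3(2) by (auto simp: subset_iff)
  define G where "G z = fst z ^ (2 * m + 1) + fst z ^ (m + 1) * \<beta> (fst z) * snd z + \<alpha> (fst z) * snd z ^ 2"
    for z
  have hol_fst: "holo2_on (\<lambda>z. \<gamma> (fst z)) (?B \<times> X)" if "\<gamma> holomorphic_on ?B" for \<gamma> and X :: "complex set"
    by (rule holo2_on_compose_holomorphic[OF that open_ball holo2_on_fst]) auto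
  have \<alpha>\<beta>: "\<alpha> holomorphic_on ?B" "\<beta> holomorphic_on ?B"
    using \<alpha>(2) \<beta>(2) sub holomorphic_on_subset by blast+
  have G: "holo2_on G (?B \<times> ?B)"
    unfolding G_def by (intro holo2_intros hol_fst \<alpha>\<beta>)

  \<comment> \<open>Off the axes the defining relation of the spectral curve holds, with \<open>y = 1/w\<close>.\<close>
  have eq: "x ^ (2 * m + 1) * w ^ 2 * f (x, w) = h' (x, w) * G (x, w)"
    if x: "x \<in> ?B" "w \<in> ?B" "x \<noteq> 0" "w \<noteq> 0" for x w
  proof -
    have "(x, w) \<in> W" using sub(3) x by blast
    then obtain R where R: "R \<in> N" "R \<in> ?K" "?\<kappa> R = (x, w)" unfolding W_def by force
    from R(2) obtain q \<xi> where q: "R = Cov q \<xi>" "q \<in> fst c" "\<xi> c \<noteq> 0" "x = snd c q" "w = 1 / \<xi> c"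
      by (rule infinity_chart_cases[OF C]) (use R(3) x(4) in auto)
    obtain q' where "q' \<in> fst c" "x = snd c q'" "poles H q' = 0" using r4(2)[of x] x r by auto
    then have "poles H q = 0" using q local_coords_inj[OF c'(1)] by (metis inj_onD)
    then have "\<Sigma> ?P R = h R * char_section H c R"
      using \<Sigma>h[OF R(1)] q by (auto simp: C_infinity_def)
    also have "char_section H c R = \<xi> c ^ 2 + ?A1 x * \<xi> c + ?A2 x"
      using q by (simp add: char_section_eq eta_def in_coord_apply[OF c'(1)])
    also have "\<xi> c = 1 / w" using q by simp
    also have "?A1 x = \<beta> x / x ^ m" using \<beta>(3) sub x by blast
    also have "?A2 x = \<alpha> x / x ^ (2 * m + 1)" using \<alpha>(4) sub x by blast
    finally have e: "\<Sigma> ?P R = h R * ((1 / w) ^ 2 + \<beta> x / x ^ m * (1 / w) + \<alpha> x / x ^ (2 * m + 1))" .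
    have "inv_into ?K ?\<kappa> (x, w) = R" using R injK inv_into_f_f by metis
    then have fR: "f (x, w) = \<Sigma> ?P R" "h' (x, w) = h R" by (simp_all add: f_def h'_def)
    have "x ^ (2 * m + 1) * w ^ 2 * ((1 / w) ^ 2 + \<beta> x / x ^ m * (1 / w) + \<alpha> x / x ^ (2 * m + 1)) =
        G (x, w)"
      using x(3,4) by (simp add: G_def field_simps power2_eq_square power_add power_mult)
    then show ?thesis unfolding fR e by (metis mult.left_commute)
  qed
  have G0: "G (0, w) \<noteq> 0" if "w \<in> ?B" "w \<noteq> 0" for w
    using \<alpha>(3)[of 0] \<alpha>(1) that by (simp add: G_def)
  have G1: "G (x, 0) \<noteq> 0" if "x \<in> ?B" "x \<noteq> 0" for x
    using that by (simp add: G_def)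
  obtain e where e: "holo2_on e (?B \<times> ?B)" "\<And>x w. x \<in> ?B \<Longrightarrow> w \<in> ?B \<Longrightarrow>
      h' (x, w) = e (x, w) * (x ^ (2 * m + 1) * w ^ 2) \<and> f (x, w) = e (x, w) * G (x, w)"
    using holo2_divide_monomial[OF r(1) holo2_on_subset[OF fh(1) sub(3)]
        holo2_on_subset[OF fh(2) sub(3)] G G0 G1 eq] by blast

  have o: "open (?B \<times> ?B)" by (simp add: open_Times)
  let ?N = "{Q \<in> ?K. ?\<kappa> Q \<in> ?B \<times> ?B}"
  have on: "open_in ?S ?N" by (rule open_in_coords_preimage[OF inj lc o])
  have f_eq: "f (?\<kappa> Q) = \<Sigma> ?P Q" "h' (?\<kappa> Q) = h Q" if "Q \<in> ?K" for Q
    using that injK by (simp_all add: f_def h'_def)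
  have split: "\<Sigma> ?P Q = e (?\<kappa> Q) * G (?\<kappa> Q) \<and>
      h Q = e (?\<kappa> Q) * (fst (?\<kappa> Q) ^ (2 * m + 1) * snd (?\<kappa> Q) ^ 2)" if "Q \<in> ?N" for Q
    using e(2)[of "fst (?\<kappa> Q)" "snd (?\<kappa> Q)"] f_eq[of Q] that by (auto simp: mem_Times_iff)
  have mono: "holo2_on (\<lambda>z. fst z ^ (2 * m + 1) * snd z ^ 2) (?B \<times> ?B)"
    by (intro holo2_intros)
  \<comment> \<open>Now \<open>e\<close> is a common factor of numerator and denominator, hence a unit at the point.\<close>
  have PN: "?P \<in> ?N" using PK r(1) by simp
  have "e (?\<kappa> ?P) \<noteq> 0"
  proof (rule N(5)[unfolded coprime_at_def, THEN spec, THEN spec, THEN spec, THEN spec, THEN mp])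
    show "open_in ?S ?N \<and> ?P \<in> ?N \<and> holo_on ?S (\<lambda>Q. e (?\<kappa> Q)) ?N \<and> holo_on ?S (\<lambda>Q. G (?\<kappa> Q)) ?N \<and>
        holo_on ?S (\<lambda>Q. fst (?\<kappa> Q) ^ (2 * m + 1) * snd (?\<kappa> Q) ^ 2) ?N \<and>
        (\<forall>Q\<in>?N. \<Sigma> ?P Q = e (?\<kappa> Q) * G (?\<kappa> Q) \<and>
          h Q = e (?\<kappa> Q) * (fst (?\<kappa> Q) ^ (2 * m + 1) * snd (?\<kappa> Q) ^ 2))"
      by (intro conjI on PN holo_on_coords_compose[OF inj lc e(1)] holo_on_coords_compose[OF inj lc G]
          holo_on_coords_compose[OF inj lc mono] ballI split)
  qed
  then have e0: "e (0, 0) \<noteq> 0" using PK by simp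

  obtain \<delta> s b where \<delta>: "0 < \<delta>" "\<delta> \<le> r" and s: "s holomorphic_on ball 0 \<delta>" and b: "b holomorphic_on ball 0 \<delta>"
    and injs: "inj_on s (ball 0 \<delta>)" and s0: "s 0 = 0" "b 0 = 0"
    and cusp: "\<And>x w. x \<in> ball 0 \<delta> \<Longrightarrow>
      x ^ (2 * m + 1) + x ^ (m + 1) * \<beta> x * w + \<alpha> x * w ^ 2 =
      \<alpha> x * ((w + b x) ^ 2 - s x ^ (2 * m + 1))"
    using cusp_normal_form[OF r(1) \<alpha>\<beta>, of m] \<alpha>(3) sub(2) by blast
  let ?D = "ball (0::complex) \<delta>"
  have D: "?D \<subseteq> ?B" using \<delta>(2) by auto
  have DD: "?D \<times> ?D \<subseteq> ?B \<times> ?B" using D by blast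
  obtain \<sigma> where \<sigma>: "\<sigma> holomorphic_on s ` ?D" "\<And>x. x \<in> ?D \<Longrightarrow> \<sigma> (s x) = x"
    using holomorphic_has_inverse[OF s open_ball injs] by metis
  have os: "open (s ` ?D)" by (rule open_mapping_thm3[OF s open_ball injs])
  \<comment> \<open>The region where \<open>e\<close> is a unit and \<open>s\<close> is a coordinate, written as the preimage of
    an open set to see that it is open.\<close>
  define W' where "W' = {z \<in> ?D \<times> ?D. (e z, 0) \<in> (- {0}) \<times> (UNIV :: complex set)}"
  have W': "open W'"
    unfolding W'_def
    by (rule open_holo2_preimage)
      (auto intro: open_Times holo2_on_subset[OF e(1) DD] holo2_on_const)
  \<comment> \<open>The coordinate change and its inverse; \<open>\<sigma>\<close> inverts \<open>s\<close>.\<close>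
  define \<theta> where "\<theta> z = (s (fst z), snd z + b (fst z))" for z
  define \<theta>' where "\<theta>' z = (\<sigma> (fst z), snd z + - b (\<sigma> (fst z)))" for z
  have hD: "holo2_on (\<lambda>z. \<gamma> (fst z)) (?D \<times> X)" if "\<gamma> holomorphic_on ?D" for \<gamma> and X :: "complex set"
    by (rule holo2_on_compose_holomorphic[OF that open_ball holo2_on_fst]) auto
  have h\<theta>: "holo2_on (\<lambda>z. fst (\<theta> z)) W'" "holo2_on (\<lambda>z. snd (\<theta> z)) W'"
    unfolding \<theta>_def fst_conv snd_conv
    by (rule holo2_on_subset[of _ "?D \<times> ?D"], intro holo2_intros hD s b, force simp: W'_def)+
  have h\<sigma>: "holo2_on (\<lambda>z. \<sigma> (fst z)) (s ` ?D \<times> UNIV)"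
    by (rule holo2_on_compose_holomorphic[OF \<sigma>(1) os holo2_on_fst]) auto
  have "holo2_on (\<lambda>z. - b (\<sigma> (fst z))) (s ` ?D \<times> UNIV)"
    by (rule holo2_on_compose_holomorphic[OF _ open_ball h\<sigma>])
      (use \<sigma>(2) in \<open>auto intro!: holomorphic_intros b\<close>)
  then have h\<theta>': "holo2_on (\<lambda>z. fst (\<theta>' z)) (s ` ?D \<times> UNIV)" "holo2_on (\<lambda>z. snd (\<theta>' z)) (s ` ?D \<times> UNIV)"
    unfolding \<theta>'_def fst_conv snd_conv by (intro holo2_intros h\<sigma>; assumption)+
  define V where "V = {z \<in> s ` ?D \<times> UNIV. (fst (\<theta>' z), snd (\<theta>' z)) \<in> W'}"
  have V: "open V"
    unfolding V_def by (rule open_holo2_preimage[OF _ h\<theta>' W']) (auto intro: open_Times os)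
  have inv1: "\<theta>' (\<theta> z) = z" if "z \<in> W'" for z
    using that \<sigma>(2) by (auto simp: \<theta>_def \<theta>'_def W'_def)
  have inv2: "\<theta> (\<theta>' z) = z" if "z \<in> V" for z
    using that \<sigma>(2) by (auto simp: \<theta>_def \<theta>'_def V_def)
  have "W' \<subseteq> ?B \<times> ?B" using DD unfolding W'_def by blast
  then have W'img: "W' \<subseteq> ?\<kappa> ` ?K" using sub(3) unfolding W_def by blast
  have "\<theta> z \<in> V" if "z \<in> W'" for z
    using that inv1[OF that] by (auto simp: V_def \<theta>_def W'_def)
  then have \<theta>V: "\<theta> ` W' \<subseteq> V" by blast
  let ?N' = "{Q \<in> ?K. ?\<kappa> Q \<in> W'}"
  have coords: "local_coords2 ?S ?N' (\<lambda>Q. \<theta> (?\<kappa> Q))"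
    by (rule local_coords2_change[OF inj lc W' W'img h\<theta> V \<theta>V _ _ inv1 inv2])
      (auto simp: V_def intro: holo2_on_subset[OF h\<theta>'(1)] holo2_on_subset[OF h\<theta>'(2)])
  let ?u = "\<lambda>z. e z * \<alpha> (fst z)"
  show ?thesis
    unfolding cusp_singularity_def
  proof (intro exI[of _ m] exI[of _ ?N'] exI[of _ "\<lambda>Q. \<theta> (?\<kappa> Q)"] exI[of _ "\<lambda>Q. ?u (?\<kappa> Q)"]
      conjI m coords ballI)
    show "?P \<in> ?N'" using PK e0 \<delta>(1) by (simp add: W'_def)
    show "\<theta> (?\<kappa> ?P) = (0, 0)" by (simp add: PK \<theta>_def s0)
    have "holo2_on ?u (?B \<times> ?B)" by (intro holo2_intros e(1) hol_fst \<alpha>\<beta>)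
    then show "holo_on ?S (\<lambda>Q. ?u (?\<kappa> Q)) ?N'"
      by (intro holo_on_coords_compose[OF inj lc] holo2_on_subset[OF _ \<open>W' \<subseteq> ?B \<times> ?B\<close>])
    fix Q assume Q: "Q \<in> ?N'"
    obtain x w where xw: "?\<kappa> Q = (x, w)" by (cases "?\<kappa> Q")
    have x: "x \<in> ?D" "e (x, w) \<noteq> 0" "Q \<in> ?N"
      using Q xw \<delta>(2) by (auto simp: W'_def)
    then have "\<alpha> x \<noteq> 0" using \<alpha>(3) D sub(2) by blast
    then show "?u (?\<kappa> Q) \<noteq> 0" using x xw by simp
    have "\<Sigma> ?P Q = e (x, w) * G (x, w)" using split[OF x(3)] xw by simp
    also have "G (x, w) = \<alpha> x * ((w + b x) ^ 2 - s x ^ (2 * m + 1))"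
      using cusp[OF x(1), of w] by (simp add: G_def)
    finally show "\<Sigma> ?P Q = ?u (?\<kappa> Q) * (snd (\<theta> (?\<kappa> Q)) ^ 2 - fst (\<theta> (?\<kappa> Q)) ^ (2 * m + 1))"
      by (simp add: xw \<theta>_def)
  qed
qed

section \<open>Blow-ups and singular points of the quantum curve\<close>

theorem theorem6p10:
  fixes C :: "'a curve" and H :: "('a, 'i) higgs" and \<Sigma> :: "'a tpoint divisor"
    and P :: "'a tpoint" and Ps :: "'a tpoint npoint list" and \<rho> :: nat
    and c :: "'a chart" and hbar :: complex
  assumes "smooth_projective_curve C"
    and "meromorphic_higgs_bundle C H"
    and "spectral_curve C H \<Sigma>"
    and "irreducible_divisor (Tbar C) \<Sigma>"
    and "P \<in> support (Tbar C) \<Sigma> \<inter> C_infinity C"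
    and "constructs_Bl C H \<Sigma> Ps"
    and "\<rho> = blowups_at_infinity C H Ps P"
    and "c \<in> coords_at C (proj P)" and "snd c (proj P) = 0"
    and "hbar \<noteq> 0"
  shows "(\<rho> = 1 \<longrightarrow> regular_singular_at_0 (quantum_curve_op H hbar c)) \<and>
    (\<rho> > 1 \<longrightarrow>
       (irregular_singular_at_0 (quantum_curve_op H hbar c) (real \<rho> - 1) \<or>
        irregular_singular_at_0 (quantum_curve_op H hbar c) (real \<rho> - 3/2)) \<and>
       (irregular_singular_at_0 (quantum_curve_op H hbar c) (real \<rho> - 3/2) \<longrightarrow>
        cusp_singularity (Tbar C) \<Sigma> P))"
proof -
  obtain p where P: "P = AtInf p" using assms(5) by (auto simp: C_infinity_def)
  have C: "riemann_surface C" using assms(1) by (simp add: smooth_projective_curve_def)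
  have c: "c \<in> coords_at C p" "snd c p = 0" using assms(8,9) P by simp_all
  have c': "c \<in> local_coords C" "p \<in> fst c" using c(1) by (auto simp: coords_at_def)
  let ?L = "quantum_curve_op H hbar c"
  let ?A1 = "in_coord c (a1 H c)" and ?A2 = "in_coord c (a2 H c)"
  define k l where "k = pole_order ?A1 0" and "l = pole_order ?A2 0"
  have mer: "?A1 meromorphic_on {0}" "?A2 meromorphic_on {0}"
    using meromorphic_a[OF C assms(2) c'] c(2) by simp_all
  have kl: "k = -\<infinity> \<or> (\<exists>n::int. k = ereal n)" "l = -\<infinity> \<or> (\<exists>n::int. l = ereal n)"
    unfolding k_def l_def by (intro integral_or_minus_infinity_pole_order mer)+
  define b1 b2 where "b1 x = inverse hbar * ?A1 x" and "b2 x = inverse hbar ^ 2 * ?A2 x" for x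
  have nf: "normal_form ?L b1 b2"
    unfolding b1_def b2_def by (rule normal_form_quantum_curve[OF assms(10) mer])
  have b: "pole_order b1 0 = k" "pole_order b2 0 = l"
    unfolding b1_def b2_def k_def l_def using assms(10) by (auto intro!: pole_order_cmult mer)
  have \<rho>: "int \<rho> = \<lceil>real_of_ereal (invariant_r k l)\<rceil>" if "0 < \<rho>"
  proof -
    have "p \<in> Delta_poles C H" "\<rho> = card {i. i < length Ps \<and> base_point (Ps ! i) = AtInf p}"
      using assms(7) that P by (auto simp: blowups_at_infinity_def split: if_splits)
    then have "int \<rho> = \<lceil>r_at C H p\<rceil>" using assms(6) unfolding constructs_Bl_def by blast
    then show ?thesis
      using form_pole_order_a[OF C assms(2) c(1)] c(2) by (simp add: r_at_def k_def l_def)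
  qed
  have "regular_singular_at_0 ?L" if "\<rho> = 1"
    unfolding regular_singular_at_0_def
    using nf invariant_r_ceiling(1)[OF kl \<rho>] that b by (intro exI[of _ b1] exI[of _ b2]) simp
  moreover have "irregular_singular_at_0 ?L (real \<rho> - 1) \<or> irregular_singular_at_0 ?L (real \<rho> - 3/2)"
    if "\<rho> > 1"
  proof -
    have "irregular_singular_at_0 ?L cl" if "ereal cl = invariant_r k l - 1" for cl
      unfolding irregular_singular_at_0_def Let_def
      using nf invariant_r_ceiling(2)[OF kl \<rho>] \<open>\<rho> > 1\<close> b that
      by (intro exI[of _ b1] exI[of _ b2]) simp
    then show ?thesis using invariant_r_ceiling(2)[OF kl \<rho>] \<open>\<rho> > 1\<close> by auto
  qed
  moreover have "cusp_singularity (Tbar C) \<Sigma> P"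
    if "\<rho> > 1" and irr: "irregular_singular_at_0 ?L (real \<rho> - 3/2)"
  proof -
    \<comment> \<open>The class is witnessed by some normal form; by uniqueness it has the pole orders \<open>k\<close> and \<open>l\<close>.\<close>
    obtain d1 d2 where d: "normal_form ?L d1 d2"
      "ereal (real \<rho> - 3/2) = invariant_r (pole_order d1 0) (pole_order d2 0) - 1"
      using irr unfolding irregular_singular_at_0_def Let_def by blast
    have "pole_order d1 0 = k" "pole_order d2 0 = l"
      using normal_form_quantum_curve_unique[OF assms(10) d(1)]
      by (auto simp: b[symmetric] b1_def b2_def intro!: pole_order_cong)
    with d(2) have "ereal (real \<rho> - 3/2) = invariant_r k l - 1" by simp
    then obtain m :: nat where "1 \<le> m" "l = ereal (2 * real m + 1)"
      "k = -\<infinity> \<or> (\<exists>n::int. k = ereal n \<and> n \<le> int m)"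
      using invariant_r_half_integral[OF kl \<open>\<rho> > 1\<close>] by metis
    then show ?thesis
      unfolding P k_def l_def by (intro cusp_at_infinity[OF C assms(2,3) c])
  qed
  ultimately show ?thesis by blast
qed

end
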